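(* Let $\alpha\geqslant\frac2\pi\big(1+\frac{1}{3\sqrt\pi}\big)$ and let $\zeta_*\in L^2$ be a non-negative solution of $\zeta_*=\varPhi(\zeta_* )$ with $\|\zeta_*\|\leqslant\frac{9\sqrt\pi}{2}$. Define $\theta(\sigma)=\frac13(H\zeta_* )(\sigma)$ and $\tau(\sigma)=\log\frac\pi2+\frac13\int_0^\sigma\zeta_*(s)\,ds$ for $\sigma\in[0,\pi/2]$. Then: 1. $(\tau'(\sigma)\sin\sigma)'\in L^2$ with $\|(\tau'\sin\sigma)'\|\leqslant 7/(\alpha\sqrt\pi)$, $\tau'(\pi/2)=0$, and $\tau\in C^{1,1/2}[\delta,\pi/2]$ for every $\delta\in(0,\pi/2)$; 2. $(\theta'(\sigma)\sin\sigma)'\in L^2$ with $\|(\theta'\sin\sigma)'\|\leqslant 7/(\alpha\sqrt\pi)$, and $\theta\in C^{1,1/2}[\delta,\pi/2]$ for every $\delta\in(0,\pi/2)$.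
   Context: $L^2$ denotes $L^2(0,\pi/2)$ with norm $\|f\|=\big(\int_0^{\pi/2}|f(\sigma)|^2\,d\sigma\big)^{1/2}$. The kernel is $K(s,\sigma)=\log\Big|\frac{\sin(s+\sigma)}{\sin(s-\sigma)}\Big|$ for $s,\sigma\in(0,\pi/2)$, $s\neq\sigma$, and for $w\in L^2$ the operator $H$ is $(Hw)(\sigma)=\frac1\pi\int_0^{\pi/2}K(s,\sigma)\,w(s)\,ds$, $\sigma\in[0,\pi/2]$. For a parameter $\alpha>0$ the nonlinear operator $\varPhi$ is defined for $\zeta\in L^2$ by $$\varPhi(\zeta)(\sigma)=\frac{3}{\alpha\pi}\,\frac{\sin\big(\sigma+\frac13(H\zeta)(\sigma)\big)\cot\sigma}{\exp\int_0^\sigma\zeta(s)\,ds},\qquad\sigma\in(0,\pi/2].$$ (Such a $\zeta_*$ exists for these $\alpha$.) $C^{1,1/2}[a,b]$ denotes continuously differentiable functions whose derivative is Hölder continuous with exponent $1/2$; derivatives are weak derivatives and $\tau'=\zeta_*/3$, with $\zeta_*$ taken as $\varPhi(\zeta_* )$ pointwise. *)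

theory Defs
  imports "HOL-Analysis.Analysis"
begin

definition L2_on :: "real \<Rightarrow> real \<Rightarrow> (real \<Rightarrow> real) \<Rightarrow> bool" where
  "L2_on a b f \<longleftrightarrow> f \<in> borel_measurable (lebesgue_on {a..b}) \<and>
      integrable (lebesgue_on {a..b}) (\<lambda>x. (f x)^2)"

definition L2_norm :: "real \<Rightarrow> real \<Rightarrow> (real \<Rightarrow> real) \<Rightarrow> real" where
  "L2_norm a b f = sqrt (\<integral>x. (f x)^2 \<partial>lebesgue_on {a..b})"

definition smooth_fun :: "(real \<Rightarrow> real) \<Rightarrow> bool" where
  "smooth_fun \<phi> \<longleftrightarrow> (\<forall>k. (deriv ^^ k) \<phi> differentiable_on UNIV)"

definition test_fun :: "real \<Rightarrow> real \<Rightarrow> (real \<Rightarrow> real) \<Rightarrow> bool" where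
  "test_fun a b \<phi> \<longleftrightarrow> smooth_fun \<phi> \<and> compact (closure {x. \<phi> x \<noteq> 0}) \<and>
      closure {x. \<phi> x \<noteq> 0} \<subseteq> {a<..<b}"

definition loc_integrable :: "real \<Rightarrow> real \<Rightarrow> (real \<Rightarrow> real) \<Rightarrow> bool" where
  "loc_integrable a b f \<longleftrightarrow> (\<forall>K. compact K \<and> K \<subseteq> {a<..<b} \<longrightarrow> integrable (lebesgue_on K) f)"

definition weak_deriv :: "real \<Rightarrow> real \<Rightarrow> (real \<Rightarrow> real) \<Rightarrow> (real \<Rightarrow> real) \<Rightarrow> bool" where
  "weak_deriv a b f g \<longleftrightarrow> loc_integrable a b f \<and> loc_integrable a b g \<and>
     (\<forall>\<phi>. test_fun a b \<phi> \<longrightarrow>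
        (\<integral>x. f x * deriv \<phi> x \<partial>lebesgue_on {a..b}) = - (\<integral>x. g x * \<phi> x \<partial>lebesgue_on {a..b}))"

definition C1_half :: "real \<Rightarrow> real \<Rightarrow> (real \<Rightarrow> real) \<Rightarrow> bool" where
  "C1_half a b f \<longleftrightarrow> (\<exists>f'. (\<forall>x\<in>{a..b}. (f has_real_derivative f' x) (at x within {a..b})) \<and>
      (\<exists>C. \<forall>x\<in>{a..b}. \<forall>y\<in>{a..b}. \<bar>f' x - f' y\<bar> \<le> C * \<bar>x - y\<bar> powr (1/2)))"

definition K_ker :: "real \<Rightarrow> real \<Rightarrow> real" where
  "K_ker s \<sigma> = ln \<bar>sin (s + \<sigma>) / sin (s - \<sigma>)\<bar>"

definition H_op :: "(real \<Rightarrow> real) \<Rightarrow> real \<Rightarrow> real" where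
  "H_op w \<sigma> = (1 / pi) * (\<integral>s. K_ker s \<sigma> * w s \<partial>lebesgue_on {0..pi/2})"

definition Phi_op :: "real \<Rightarrow> (real \<Rightarrow> real) \<Rightarrow> real \<Rightarrow> real" where
  "Phi_op \<alpha> \<zeta> \<sigma> = (3 / (\<alpha> * pi)) * (sin (\<sigma> + (1/3) * H_op \<zeta> \<sigma>) * cot \<sigma>)
      / exp (\<integral>s. \<zeta> s \<partial>lebesgue_on {0..\<sigma>})"

end

theory Submission
  imports Defs
begin

text \<open>
  The kernel has the expansion \<open>K(s,\<sigma>) = 2 \<Sum>\<^sub>k sin(2ks) sin(2k\<sigma>)/k\<close>, so \<open>H\<close> sends \<open>\<Sum> b\<^sub>k sin(2ks)\<close> to
  \<open>\<Sum> b\<^sub>k sin(2k\<sigma>)/(2k)\<close>, and \<open>(Hw)'\<close> is the conjugate series \<open>\<Sum> b\<^sub>k cos(2k\<sigma>)\<close>, of norm at most \<open>\<parallel>w\<parallel>\<close>.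
  Differentiating \<open>\<tau>' sin = (1/(\<alpha>\<pi>)) sin(\<sigma>+\<theta>) cos \<sigma> exp(-\<integral>\<zeta>)\<close> bounds \<open>\<parallel>(\<tau>' sin)'\<parallel>\<close> by
  \<open>(\<surd>(\<pi>/2) + \<parallel>\<zeta>\<parallel>/3 + \<parallel>\<zeta>\<parallel>)/(\<alpha>\<pi>)\<close>, which is at most \<open>7/(\<alpha>\<surd>\<pi>)\<close>.

  Multiplication by \<open>sin\<close> shifts frequencies by one: \<open>\<tau>' sin\<close> is a series in \<open>cos((2k+1)\<sigma>)\<close> and
  \<open>\<theta>' sin\<close> is, up to sign, the series in \<open>sin((2k+1)\<sigma>)\<close> with the same coefficients. As \<open>\<tau>' sin\<close>
  vanishes at \<open>\<pi>/2\<close>, both may be differentiated termwise, and \<open>\<parallel>(\<theta>' sin)'\<parallel> \<le> \<parallel>(\<tau>' sin)'\<parallel>\<close>.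
  Only the Bessel inequality and the Riesz-Fischer theorem are needed, not completeness of the
  trigonometric systems.
\<close>

section \<open>Square-integrable functions on an interval\<close>

lemma L2_onD:
  assumes "L2_on a b f"
  shows "f \<in> borel_measurable (lebesgue_on {a..b})"
    and "integrable (lebesgue_on {a..b}) (\<lambda>x. (f x)\<^sup>2)"
  using assms by (auto simp: L2_on_def)

lemma L2_on_bound:
  assumes "L2_on a b g" "f \<in> borel_measurable (lebesgue_on {a..b})"
    and "\<And>x. x \<in> {a..b} \<Longrightarrow> \<bar>f x\<bar> \<le> \<bar>g x\<bar>"
  shows "L2_on a b f"
proof -
  have "integrable (lebesgue_on {a..b}) (\<lambda>x. (f x)\<^sup>2)"
  proof (rule Bochner_Integration.integrable_bound[OF L2_onD(2)[OF assms(1)]])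
    show "(\<lambda>x. (f x)\<^sup>2) \<in> borel_measurable (lebesgue_on {a..b})"
      using assms(2) by measurable
    show "AE x in lebesgue_on {a..b}. norm ((f x)\<^sup>2) \<le> norm ((g x)\<^sup>2)"
      using assms(3) by (intro AE_I2) (auto simp: abs_le_square_iff)
  qed
  with assms(2) show ?thesis by (simp add: L2_on_def)
qed

lemma L2_on_cmult:
  assumes "L2_on a b f" shows "L2_on a b (\<lambda>x. c * f x)"
  using assms unfolding L2_on_def by (auto simp: power_mult_distrib)

lemma L2_on_add:
  assumes "L2_on a b f" "L2_on a b g"
  shows "L2_on a b (\<lambda>x. f x + g x)"
proof -
  note [measurable] = L2_onD(1)[OF assms(1)] L2_onD(1)[OF assms(2)]
  have "integrable (lebesgue_on {a..b}) (\<lambda>x. (f x + g x)\<^sup>2)"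
  proof (rule Bochner_Integration.integrable_bound)
    show "integrable (lebesgue_on {a..b}) (\<lambda>x. 2 * (f x)\<^sup>2 + 2 * (g x)\<^sup>2)"
      using assms by (auto simp: L2_on_def)
    have "(f x + g x)\<^sup>2 \<le> 2 * (f x)\<^sup>2 + 2 * (g x)\<^sup>2" for x
      using zero_le_power2[of "f x - g x"] by (simp add: power2_eq_square algebra_simps)
    then show "AE x in lebesgue_on {a..b}. norm ((f x + g x)\<^sup>2) \<le> norm (2 * (f x)\<^sup>2 + 2 * (g x)\<^sup>2)"
      by (intro AE_I2) auto
  qed measurable
  then show ?thesis by (simp add: L2_on_def)
qed

lemma L2_on_diff:
  assumes "L2_on a b f" "L2_on a b g"
  shows "L2_on a b (\<lambda>x. f x - g x)"
  using L2_on_add[OF assms(1) L2_on_cmult[OF assms(2), of "-1"]] by simp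

lemma L2_on_sum:
  assumes "\<And>k. L2_on a b (f k)"
  shows "L2_on a b (\<lambda>x. \<Sum>k<(n::nat). f k x)"
proof (induction n)
  case 0
  show ?case by (simp add: L2_on_def)
next
  case (Suc n)
  then show ?case using L2_on_add[OF Suc assms[of n]] by simp
qed

lemma L2_on_abs:
  assumes "L2_on a b f" shows "L2_on a b (\<lambda>x. \<bar>f x\<bar>)"
  using assms by (auto simp: L2_on_def)

lemma continuous_imp_L2_on:
  assumes "continuous_on {a..b} f" shows "L2_on a b f"
proof -
  have "integrable (lebesgue_on {a..b}) (\<lambda>x. (f x)\<^sup>2)"
    by (rule continuous_imp_integrable_real) (intro continuous_intros assms)
  moreover have "f \<in> borel_measurable (lebesgue_on {a..b})"
    by (rule continuous_imp_measurable_on_sets_lebesgue[OF assms]) auto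
  ultimately show ?thesis by (simp add: L2_on_def)
qed

lemma L2_on_integrable_mult:
  assumes "L2_on a b f" "L2_on a b g"
  shows "integrable (lebesgue_on {a..b}) (\<lambda>x. f x * g x)"
proof (rule Bochner_Integration.integrable_bound)
  note [measurable] = L2_onD(1)[OF assms(1)] L2_onD(1)[OF assms(2)]
  show "integrable (lebesgue_on {a..b}) (\<lambda>x. (f x)\<^sup>2 + (g x)\<^sup>2)"
    using assms by (auto simp: L2_on_def)
  show "(\<lambda>x. f x * g x) \<in> borel_measurable (lebesgue_on {a..b})" by measurable
  have "\<bar>x * y\<bar> \<le> x\<^sup>2 + y\<^sup>2" for x y :: real
    using sum_squares_bound[of "\<bar>x\<bar>" "\<bar>y\<bar>"] mult_nonneg_nonneg[of "\<bar>x\<bar>" "\<bar>y\<bar>"]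
    unfolding abs_mult power2_abs by linarith
  then show "AE x in lebesgue_on {a..b}. norm (f x * g x) \<le> norm ((f x)\<^sup>2 + (g x)\<^sup>2)"
    by (intro AE_I2) auto
qed

lemma L2_on_const: "L2_on a b (\<lambda>x. c)"
  by (rule continuous_imp_L2_on) auto

lemma L2_on_integrable:
  assumes "L2_on a b f"
  shows "integrable (lebesgue_on {a..b}) f"
  using L2_on_integrable_mult[OF assms L2_on_const[of a b 1]] by simp

lemma L2_norm_nonneg: "0 \<le> L2_norm a b f"
  by (simp add: L2_norm_def)

lemma L2_norm_power2: "(L2_norm a b f)\<^sup>2 = (\<integral>x. (f x)\<^sup>2 \<partial>lebesgue_on {a..b})"
  by (simp add: L2_norm_def)

lemma L2_norm_const: "a \<le> b \<Longrightarrow> L2_norm a b (\<lambda>x. c) = \<bar>c\<bar> * sqrt (b - a)"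
  by (simp add: L2_norm_def real_sqrt_mult measure_restrict_space)

lemma L2_norm_cmult: "L2_norm a b (\<lambda>x. c * f x) = \<bar>c\<bar> * L2_norm a b f"
  by (simp add: L2_norm_def power_mult_distrib real_sqrt_mult)

lemma L2_norm_abs: "L2_norm a b (\<lambda>x. \<bar>f x\<bar>) = L2_norm a b f"
  by (simp add: L2_norm_def)

lemma L2_norm_mono:
  assumes "L2_on a b f" "L2_on a b g" "\<And>x. x \<in> {a..b} \<Longrightarrow> \<bar>f x\<bar> \<le> \<bar>g x\<bar>"
  shows "L2_norm a b f \<le> L2_norm a b g"
  unfolding L2_norm_def using assms
  by (intro real_sqrt_le_mono integral_mono) (auto simp: L2_on_def abs_le_square_iff)

text \<open>The squared norm of \<open>s * f + t * g\<close> is a non-negative quadratic form in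
  \<open>s\<close> and \<open>t\<close>; suitable values of the two parameters give the discriminant
  inequality.\<close>

lemma L2_Cauchy_Schwarz:
  assumes f: "L2_on a b f" and g: "L2_on a b g"
  shows "\<bar>\<integral>x. f x * g x \<partial>lebesgue_on {a..b}\<bar> \<le> L2_norm a b f * L2_norm a b g"
proof -
  let ?M = "lebesgue_on {a..b}"
  define A where "A = (\<integral>x. (f x)\<^sup>2 \<partial>?M)"
  define B where "B = (\<integral>x. f x * g x \<partial>?M)"
  define C where "C = (\<integral>x. (g x)\<^sup>2 \<partial>?M)"
  note [simp] = L2_onD(2)[OF f] L2_onD(2)[OF g] L2_on_integrable_mult[OF f g]
  have pos: "0 \<le> s\<^sup>2 * A + 2 * s * t * B + t\<^sup>2 * C" for s t
  proof -
    have "0 \<le> (\<integral>x. (s * f x + t * g x)\<^sup>2 \<partial>?M)"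
      by (rule integral_nonneg_AE) simp
    also have "\<dots> = (\<integral>x. s\<^sup>2 * (f x)\<^sup>2 + (2 * s * t) * (f x * g x) + t\<^sup>2 * (g x)\<^sup>2 \<partial>?M)"
      by (rule Bochner_Integration.integral_cong) (auto simp: power2_eq_square algebra_simps)
    also have "\<dots> = s\<^sup>2 * A + 2 * s * t * B + t\<^sup>2 * C"
      by (simp add: A_def B_def C_def)
    finally show ?thesis .
  qed
  have AC: "0 \<le> A" "0 \<le> C" using pos[of 1 0] pos[of 0 1] by auto
  have "B\<^sup>2 \<le> A * C"
  proof (cases "C = 0")
    case True
    show ?thesis
    proof (rule ccontr)
      assume "\<not> B\<^sup>2 \<le> A * C"
      then have "B \<noteq> 0" using True by auto
      \<comment> \<open>With \<open>C = 0\<close> this choice of \<open>t\<close> gives the form the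
        value \<open>A - (A + 1) = -1\<close>.\<close>
      then show False
        using pos[of 1 "- (A + 1) / (2 * B)"] True by (simp add: field_simps)
    qed
  next
    case False
    then have "C > 0" using AC by simp
    \<comment> \<open>At \<open>s = C\<close>, \<open>t = -B\<close> the form factors as
      \<open>C * (A * C - B * B)\<close>.\<close>
    have "0 \<le> C * (A * C - B\<^sup>2)"
      using pos[of C "-B"] by (simp add: power2_eq_square algebra_simps)
    then show ?thesis using \<open>C > 0\<close> by (simp add: zero_le_mult_iff)
  qed
  then have "sqrt (B\<^sup>2) \<le> sqrt (A * C)" by (rule real_sqrt_le_mono)
  then show ?thesis
    by (simp add: L2_norm_def A_def B_def C_def real_sqrt_mult)
qed

lemma L2_norm_triangle:
  assumes f: "L2_on a b f" and g: "L2_on a b g"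
  shows "L2_norm a b (\<lambda>x. f x + g x) \<le> L2_norm a b f + L2_norm a b g"
proof (rule power2_le_imp_le)
  let ?M = "lebesgue_on {a..b}"
  note [simp] = L2_onD(2)[OF f] L2_onD(2)[OF g] L2_on_integrable_mult[OF f g]
  have "(L2_norm a b (\<lambda>x. f x + g x))\<^sup>2 = (\<integral>x. (f x)\<^sup>2 + 2 * (f x * g x) + (g x)\<^sup>2 \<partial>?M)"
    unfolding L2_norm_power2
    by (rule Bochner_Integration.integral_cong) (auto simp: power2_eq_square algebra_simps)
  also have "\<dots> = (L2_norm a b f)\<^sup>2 + 2 * (\<integral>x. f x * g x \<partial>?M) + (L2_norm a b g)\<^sup>2"
    by (simp add: L2_norm_power2)
  also have "\<dots> \<le> (L2_norm a b f + L2_norm a b g)\<^sup>2"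
    using L2_Cauchy_Schwarz[OF f g] by (simp add: power2_eq_square algebra_simps)
  finally show "(L2_norm a b (\<lambda>x. f x + g x))\<^sup>2 \<le> (L2_norm a b f + L2_norm a b g)\<^sup>2" .
qed (simp add: L2_norm_nonneg)

lemma L2_integral_abs_le:
  assumes "L2_on a b f" "a \<le> b"
  shows "(\<integral>x. \<bar>f x\<bar> \<partial>lebesgue_on {a..b}) \<le> sqrt (b - a) * L2_norm a b f"
  using L2_Cauchy_Schwarz[OF L2_on_const[of a b 1] L2_on_abs[OF assms(1)]] assms(2)
  by (simp add: L2_norm_const L2_norm_abs)

section \<open>Orthogonal systems\<close>

text \<open>A common squared norm \<open>c\<close> replaces normalisation: the sines and cosines
  used below all have squared norm \<open>pi/4\<close>.\<close>

definition orthogonal_system :: "real \<Rightarrow> real \<Rightarrow> real \<Rightarrow> (nat \<Rightarrow> real \<Rightarrow> real) \<Rightarrow> bool" where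
  "orthogonal_system a b c e \<longleftrightarrow> (\<forall>k. L2_on a b (e k)) \<and>
     (\<forall>j k. (\<integral>x. e j x * e k x \<partial>lebesgue_on {a..b}) = (if j = k then c else 0))"

lemma orthogonal_systemD:
  assumes "orthogonal_system a b c e"
  shows "L2_on a b (e k)"
    and "(\<integral>x. e j x * e k x \<partial>lebesgue_on {a..b}) = (if j = k then c else 0)"
  using assms by (auto simp: orthogonal_system_def)

lemma orthogonal_sum_mult:
  assumes "orthogonal_system a b c e" "L2_on a b f"
  shows "(\<integral>x. f x * (\<Sum>k<n. d k * e k x) \<partial>lebesgue_on {a..b})
    = (\<Sum>k<(n::nat). d k * (\<integral>x. f x * e k x \<partial>lebesgue_on {a..b}))"
proof -
  note [simp] = L2_on_integrable_mult[OF assms(2) orthogonal_systemD(1)[OF assms(1)]]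
  have "(\<integral>x. f x * (\<Sum>k<n. d k * e k x) \<partial>lebesgue_on {a..b})
    = (\<integral>x. (\<Sum>k<n. d k * (f x * e k x)) \<partial>lebesgue_on {a..b})"
    by (rule Bochner_Integration.integral_cong) (auto simp: sum_distrib_left algebra_simps)
  then show ?thesis by simp
qed

lemma orthogonal_sum_L2_on:
  assumes "orthogonal_system a b c e"
  shows "L2_on a b (\<lambda>x. \<Sum>k<n. d k * e k x)"
  by (intro L2_on_sum L2_on_cmult orthogonal_systemD(1)[OF assms])

lemma orthogonal_sum_power2:
  assumes e: "orthogonal_system a b c e"
  shows "(\<integral>x. (\<Sum>k<n. d k * e k x)\<^sup>2 \<partial>lebesgue_on {a..b}) = c * (\<Sum>k<n. (d k)\<^sup>2)"
proof -
  let ?M = "lebesgue_on {a..b}"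
  let ?S = "\<lambda>x. \<Sum>k<n. d k * e k x"
  have "(\<integral>x. (?S x)\<^sup>2 \<partial>?M) = (\<Sum>k<n. d k * (\<integral>x. ?S x * e k x \<partial>?M))"
    using orthogonal_sum_mult[OF e orthogonal_sum_L2_on[OF e, of d n], of d n]
    by (simp add: power2_eq_square)
  also have "\<dots> = (\<Sum>k<n. d k * (d k * c))"
  proof (intro sum.cong refl)
    fix k assume "k \<in> {..<n}"
    have "(\<integral>x. ?S x * e k x \<partial>?M) = (\<integral>x. e k x * ?S x \<partial>?M)"
      by (simp add: mult.commute)
    also have "\<dots> = (\<Sum>j<n. d j * (if k = j then c else 0))"
      by (simp add: orthogonal_sum_mult[OF e orthogonal_systemD(1)[OF e]] orthogonal_systemD(2)[OF e])
    also have "\<dots> = d k * c" using \<open>k \<in> {..<n}\<close> by (simp add: if_distrib cong: if_cong)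
    finally show "d k * (\<integral>x. ?S x * e k x \<partial>?M) = d k * (d k * c)" by simp
  qed
  also have "\<dots> = c * (\<Sum>k<n. (d k)\<^sup>2)"
    by (simp add: sum_distrib_left power2_eq_square algebra_simps)
  finally show ?thesis .
qed

text \<open>Expand the squared distance from \<open>f\<close> to its projection; the choice of
  \<open>d\<close> makes the integral of \<open>f * ?S\<close> equal to the squared norm of
  \<open>?S\<close>.\<close>

lemma Bessel_inequality:
  assumes e: "orthogonal_system a b c e" and f: "L2_on a b f" and c: "c > 0"
    and d: "\<And>k. d k = (\<integral>x. f x * e k x \<partial>lebesgue_on {a..b}) / c"
  shows "c * (\<Sum>k<n. (d k)\<^sup>2) \<le> (\<integral>x. (f x)\<^sup>2 \<partial>lebesgue_on {a..b})"
proof -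
  let ?M = "lebesgue_on {a..b}"
  let ?S = "\<lambda>x. \<Sum>k<n. d k * e k x"
  note S = orthogonal_sum_L2_on[OF e, of d n]
  note [simp] = L2_onD(2)[OF f] L2_onD(2)[OF S] L2_on_integrable_mult[OF f S]
  have "(\<integral>x. f x * e k x \<partial>?M) = c * d k" for k using d c by simp
  then have fS: "(\<integral>x. f x * ?S x \<partial>?M) = c * (\<Sum>k<n. (d k)\<^sup>2)"
    by (subst orthogonal_sum_mult[OF e f]) (simp add: sum_distrib_left power2_eq_square algebra_simps)
  have "0 \<le> (\<integral>x. (f x - ?S x)\<^sup>2 \<partial>?M)"
    by (rule integral_nonneg_AE) simp
  also have "\<dots> = (\<integral>x. (f x)\<^sup>2 - 2 * (f x * ?S x) + (?S x)\<^sup>2 \<partial>?M)"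
    by (rule Bochner_Integration.integral_cong) (auto simp: power2_eq_square algebra_simps)
  also have "\<dots> = (\<integral>x. (f x)\<^sup>2 \<partial>?M) - 2 * (\<integral>x. f x * ?S x \<partial>?M) + (\<integral>x. (?S x)\<^sup>2 \<partial>?M)"
    by simp
  finally show ?thesis by (simp add: fS orthogonal_sum_power2[OF e])
qed

text \<open>Increments along a fast subsequence are summable in L1, which gives a pointwise limit
  almost everywhere; Fatou's lemma then carries the tail estimate over to it. The subsequence is
  kept in the conclusion because later arguments compare and multiply the series pointwise.\<close>

lemma Riesz_Fischer:
  assumes e: "orthogonal_system a b c e" and c: "c > 0" and "a \<le> b"
    and d: "summable (\<lambda>k. (d k)\<^sup>2)"
  obtains v r where "L2_on a b v"
    "(\<lambda>n. L2_norm a b (\<lambda>x. v x - (\<Sum>k<n. d k * e k x))) \<longlonglongrightarrow> 0"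
    "strict_mono (r :: nat \<Rightarrow> nat)"
    "AE x in lebesgue_on {a..b}. (\<lambda>n. \<Sum>k<r n. d k * e k x) \<longlonglongrightarrow> v x"
proof -
  let ?M = "lebesgue_on {a..b}"
  define S where "S = (\<lambda>n x. \<Sum>k<n. d k * e k x)"
  \<comment> \<open>\<open>T m\<close> is the tail of the series of squared norms and will bound the
    squared distance of \<open>S m\<close> from the limit.\<close>
  define T where "T = (\<lambda>n. c * (\<Sum>k. (d (k + n))\<^sup>2))"
  have S: "L2_on a b (S n)" for n
    unfolding S_def by (rule orthogonal_sum_L2_on[OF e])
  note [measurable] = L2_onD(1)[OF S]
  have T0: "T \<longlonglongrightarrow> 0"
    unfolding T_def using tendsto_mult[OF tendsto_const suminf_exist_split2[OF d]] by simp
  have Tnn: "0 \<le> T n" for n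
    unfolding T_def using c by (intro mult_nonneg_nonneg suminf_nonneg summable_ignore_initial_segment d) auto
  have ST: "(\<integral>x. (S n x - S m x)\<^sup>2 \<partial>?M) \<le> T m" if "m \<le> n" for m n
  proof -
    \<comment> \<open>With the first \<open>m\<close> coefficients set to zero, the difference of
      two partial sums is a single partial sum of length \<open>n\<close>, to which
      \<open>orthogonal_sum_power2\<close> applies.\<close>
    define d' where "d' = (\<lambda>k. if k < m then 0 else d k)"
    have "S n x = S m x + (\<Sum>k<n. d' k * e k x)" for x
    proof -
      have "(\<Sum>k<n. d' k * e k x) = (\<Sum>k\<in>{..<n} - {..<m}. d k * e k x)"
        by (rule sum.mono_neutral_cong_right) (auto simp: d'_def)
      moreover have "S n x = (\<Sum>k\<in>{..<n} - {..<m}. d k * e k x) + S m x"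
        unfolding S_def using that by (intro sum.subset_diff) auto
      ultimately show ?thesis by simp
    qed
    then have "(\<integral>x. (S n x - S m x)\<^sup>2 \<partial>?M) = c * (\<Sum>k<n. (d' k)\<^sup>2)"
      by (simp add: orthogonal_sum_power2[OF e])
    also have "(\<Sum>k<n. (d' k)\<^sup>2) = (\<Sum>k\<in>{m..<n}. (d k)\<^sup>2)"
      by (rule sum.mono_neutral_cong_right) (auto simp: d'_def)
    also have "\<dots> = (\<Sum>k<n - m. (d (k + m))\<^sup>2)"
      using sum.shift_bounds_nat_ivl[of "\<lambda>k. (d k)\<^sup>2" 0 m "n - m"] that
      by (simp add: atLeast0LessThan)
    also have "c * \<dots> \<le> T m"
      unfolding T_def using c
      by (intro mult_left_mono sum_le_suminf summable_ignore_initial_segment d) auto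
    finally show ?thesis .
  qed
  have "\<exists>r. strict_mono r \<and> (\<forall>j. T (r j) \<le> (1/4) ^ j)"
  proof -
    have ev: "\<exists>N. \<forall>n\<ge>N. T n \<le> (1/4) ^ j" for j
      using order_tendstoD(2)[OF T0, of "(1/4)^j"]
      unfolding eventually_sequentially by (force intro: less_imp_le)
    then obtain N where N: "\<And>j n. n \<ge> N j \<Longrightarrow> T n \<le> (1/4) ^ j" by metis
    \<comment> \<open>The maximum enforces both strict growth and
      \<open>r j \<ge> N j\<close>.\<close>
    define r where "r = rec_nat (N 0) (\<lambda>j m. max (Suc m) (N (Suc j)))"
    have r: "r 0 = N 0" "r (Suc j) = max (Suc (r j)) (N (Suc j))" for j
      by (simp_all add: r_def)
    have "strict_mono r" by (auto simp: strict_mono_Suc_iff r less_max_iff_disj)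
    moreover have "r j \<ge> N j" for j by (cases j) (auto simp: r)
    ultimately show ?thesis using N by blast
  qed
  then obtain r where r: "strict_mono r" and Tr: "\<And>j. T (r j) \<le> (1/4) ^ j" by blast
  have L2r: "L2_norm a b (\<lambda>x. S (r (Suc j)) x - S (r j) x) \<le> (1/2) ^ j" for j
  proof -
    have "(\<integral>x. (S (r (Suc j)) x - S (r j) x)\<^sup>2 \<partial>?M) \<le> (1/4) ^ j"
      using ST[of "r j" "r (Suc j)"] Tr[of j] strict_monoD[OF r, of j "Suc j"] by simp
    also have "(1/4::real) ^ j = ((1/2) ^ j)\<^sup>2"
      by (simp add: power2_eq_square flip: power_mult_distrib)
    finally have "sqrt (\<integral>x. (S (r (Suc j)) x - S (r j) x)\<^sup>2 \<partial>?M) \<le> sqrt (((1/2) ^ j)\<^sup>2)"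
      by (rule real_sqrt_le_mono)
    then show ?thesis by (simp add: L2_norm_def)
  qed
  define D where "D = (\<lambda>j x. S (r (Suc j)) x - S (r j) x)"
  have DL2: "L2_on a b (D j)" for j unfolding D_def by (intro L2_on_diff S)
  note [measurable] = L2_onD(1)[OF DL2]
  \<comment> \<open>On a bounded interval the L1 norm of \<open>D j\<close> is at most
    \<open>sqrt (b - a) * (1/2) ^ j\<close>, so the sum of the absolute values has a finite
    integral.\<close>
  have "AE x in ?M. (\<Sum>j. ennreal \<bar>D j x\<bar>) \<noteq> \<infinity>"
  proof (rule nn_integral_PInf_AE)
    have "(\<integral>\<^sup>+x. (\<Sum>j. ennreal \<bar>D j x\<bar>) \<partial>?M) = (\<Sum>j. (\<integral>\<^sup>+x. ennreal \<bar>D j x\<bar> \<partial>?M))"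
      by (rule nn_integral_suminf) measurable
    also have "\<dots> = (\<Sum>j. ennreal (\<integral>x. \<bar>D j x\<bar> \<partial>?M))"
      by (intro suminf_cong nn_integral_eq_integral L2_on_integrable L2_on_abs DL2) auto
    also have "\<dots> \<le> (\<Sum>j. ennreal (sqrt (b - a) * (1/2) ^ j))"
    proof (intro suminf_le ennreal_leI)
      fix j
      show "(\<integral>x. \<bar>D j x\<bar> \<partial>?M) \<le> sqrt (b - a) * (1/2) ^ j"
        using L2_integral_abs_le[OF DL2[of j] \<open>a \<le> b\<close>] L2r[of j] \<open>a \<le> b\<close>
        unfolding D_def by (meson order_trans mult_left_mono real_sqrt_ge_zero diff_ge_0_iff_ge)
    qed auto
    also have "\<dots> = ennreal (\<Sum>j. sqrt (b - a) * (1/2) ^ j)"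
      using \<open>a \<le> b\<close> by (intro suminf_ennreal2) auto
    finally show "(\<integral>\<^sup>+x. (\<Sum>j. ennreal \<bar>D j x\<bar>) \<partial>?M) \<noteq> \<infinity>"
      by (auto simp: top_unique)
  qed measurable
  then have AEconv: "AE x in ?M. convergent (\<lambda>j. S (r j) x)"
  proof eventually_elim
    case (elim x)
    have "summable (\<lambda>j. \<bar>D j x\<bar>)"
      by (rule summable_suminf_not_top) (use elim in auto)
    then have "summable (\<lambda>j. D j x)" by (rule summable_rabs_cancel)
    then have "convergent (\<lambda>n. \<Sum>j<n. D j x)" by (simp add: summable_iff_convergent)
    moreover have "(\<Sum>j<n. D j x) = S (r n) x - S (r 0) x" for n
      by (induction n) (simp_all add: D_def)
    ultimately have "convergent (\<lambda>n. S (r n) x - S (r 0) x)" by simp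
    then show ?case
      by (simp add: convergent_diff_const_right_iff)
  qed
  \<comment> \<open>On the null set where the subsequence diverges \<open>lim\<close> has an
    unspecified value; the limit function is measurable all the same.\<close>
  define v where "v = (\<lambda>x. lim (\<lambda>j. S (r j) x))"
  have vm[measurable]: "v \<in> borel_measurable ?M"
    unfolding v_def by measurable
  have AEv: "AE x in ?M. (\<lambda>j. S (r j) x) \<longlonglongrightarrow> v x"
    using AEconv by eventually_elim (simp add: v_def convergent_LIMSEQ_iff)
  \<comment> \<open>Fatou's lemma is applied to the \<open>ennreal\<close> integral, since square
    integrability of \<open>v - S m\<close> is itself a consequence of this estimate.\<close>
  have bound: "(\<integral>\<^sup>+x. ennreal ((v x - S m x)\<^sup>2) \<partial>?M) \<le> ennreal (T m)" for m
  proof -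
    have "(\<integral>\<^sup>+x. ennreal ((v x - S m x)\<^sup>2) \<partial>?M) = (\<integral>\<^sup>+x. liminf (\<lambda>j. ennreal ((S (r j) x - S m x)\<^sup>2)) \<partial>?M)"
    proof (rule nn_integral_cong_AE, use AEv in eventually_elim)
      case (elim x)
      then have "(\<lambda>j. ennreal ((S (r j) x - S m x)\<^sup>2)) \<longlonglongrightarrow> ennreal ((v x - S m x)\<^sup>2)"
        by (intro tendsto_intros)
      then show ?case by (intro lim_imp_Liminf[symmetric]) auto
    qed
    also have "\<dots> \<le> liminf (\<lambda>j. (\<integral>\<^sup>+x. ennreal ((S (r j) x - S m x)\<^sup>2) \<partial>?M))"
      by (rule nn_integral_liminf) measurable
    also have "\<dots> \<le> ennreal (T m)"
    proof (rule Liminf_le)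
      show "\<forall>\<^sub>F j in sequentially. (\<integral>\<^sup>+x. ennreal ((S (r j) x - S m x)\<^sup>2) \<partial>?M) \<le> ennreal (T m)"
        using eventually_ge_at_top[of m]
      proof eventually_elim
        case (elim j)
        then have "m \<le> r j" using seq_suble[OF r, of j] by simp
        then have "ennreal (\<integral>x. (S (r j) x - S m x)\<^sup>2 \<partial>?M) \<le> ennreal (T m)"
          by (intro ennreal_leI ST)
        then show ?case
          by (subst nn_integral_eq_integral) (auto intro!: L2_onD(2) L2_on_diff S)
      qed
    qed auto
    finally show ?thesis .
  qed
  have vS: "L2_on a b (\<lambda>x. v x - S m x)" for m
  proof -
    have "integrable ?M (\<lambda>x. (v x - S m x)\<^sup>2)"
      by (rule integrableI_nonneg) (use bound[of m] in \<open>auto simp: less_top[symmetric] top_unique\<close>)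
    then show ?thesis by (simp add: L2_on_def)
  qed
  \<comment> \<open>\<open>S 0\<close> is the empty sum.\<close>
  have "L2_on a b v" using vS[of 0] by (simp add: S_def)
  moreover have "(\<lambda>n. L2_norm a b (\<lambda>x. v x - S n x)) \<longlonglongrightarrow> 0"
  proof (rule tendsto_sandwich[where f = "\<lambda>_. 0" and h = "\<lambda>n. sqrt (T n)"])
    show "\<forall>\<^sub>F n in sequentially. L2_norm a b (\<lambda>x. v x - S n x) \<le> sqrt (T n)"
    proof (intro always_eventually allI)
      fix n
      have "ennreal (\<integral>x. (v x - S n x)\<^sup>2 \<partial>?M) \<le> ennreal (T n)"
        using bound[of n] by (subst (asm) nn_integral_eq_integral) (use vS in \<open>auto intro!: L2_onD(2)\<close>)
      then show "L2_norm a b (\<lambda>x. v x - S n x) \<le> sqrt (T n)"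
        unfolding L2_norm_def using Tnn[of n] by (simp add: ennreal_le_iff)
    qed
    show "(\<lambda>n. sqrt (T n)) \<longlonglongrightarrow> 0"
      using tendsto_real_sqrt[OF T0] by simp
  qed (auto simp: L2_norm_nonneg)
  ultimately show thesis
    using that r AEv unfolding S_def by blast
qed

section \<open>Passing to L2 limits under integrals\<close>

lemma AE_lebesgue_on_neq: "AE x in lebesgue_on {a..b}. x \<noteq> (c::real)"
proof -
  have "AE x in lebesgue. x \<noteq> c"
    by (rule AE_I'[of "{c}"]) auto
  then show ?thesis
    by (subst AE_restrict_space_iff) (auto elim!: eventually_mono)
qed

lemma tendsto_L2_integral_mult:
  assumes f: "L2_on a b f" and v: "L2_on a b v" and S: "\<And>n. L2_on a b (S n)"
    and lim: "(\<lambda>n. L2_norm a b (\<lambda>x. v x - S n x)) \<longlonglongrightarrow> 0"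
  shows "(\<lambda>n. \<integral>x. f x * S n x \<partial>lebesgue_on {a..b}) \<longlonglongrightarrow> (\<integral>x. f x * v x \<partial>lebesgue_on {a..b})"
proof -
  let ?M = "lebesgue_on {a..b}"
  have "(\<lambda>n. (\<integral>x. f x * v x \<partial>?M) - (\<integral>x. f x * S n x \<partial>?M)) \<longlonglongrightarrow> 0"
  proof (rule Lim_null_comparison)
    show "\<forall>\<^sub>F n in sequentially. norm ((\<integral>x. f x * v x \<partial>?M) - (\<integral>x. f x * S n x \<partial>?M))
        \<le> L2_norm a b f * L2_norm a b (\<lambda>x. v x - S n x)"
    proof (intro always_eventually allI)
      fix n
      have "(\<integral>x. f x * v x \<partial>?M) - (\<integral>x. f x * S n x \<partial>?M) = (\<integral>x. f x * (v x - S n x) \<partial>?M)"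
        by (simp add: right_diff_distrib L2_on_integrable_mult f v S)
      then show "norm ((\<integral>x. f x * v x \<partial>?M) - (\<integral>x. f x * S n x \<partial>?M))
          \<le> L2_norm a b f * L2_norm a b (\<lambda>x. v x - S n x)"
        using L2_Cauchy_Schwarz[OF f L2_on_diff[OF v S[of n]]] by simp
    qed
    show "(\<lambda>n. L2_norm a b f * L2_norm a b (\<lambda>x. v x - S n x)) \<longlonglongrightarrow> 0"
      using tendsto_mult[OF tendsto_const lim] by simp
  qed
  from tendsto_diff[OF tendsto_const[of "\<integral>x. f x * v x \<partial>?M"] this] show ?thesis by simp
qed

lemma integral_subinterval_abs_le:
  fixes f :: "real \<Rightarrow> real"
  assumes f: "integrable (lebesgue_on {a..b}) f" and sub: "{c..d} \<subseteq> {a..b}"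
  shows "\<bar>\<integral>x. f x \<partial>lebesgue_on {c..d}\<bar> \<le> (\<integral>x. \<bar>f x\<bar> \<partial>lebesgue_on {a..b})"
proof -
  have abs: "integrable (lebesgue_on {a..b}) (\<lambda>x. \<bar>f x\<bar>)"
    using f by simp
  note abs' = integrable_subinterval[OF abs sub]
  have "\<bar>\<integral>x. f x \<partial>lebesgue_on {c..d}\<bar> \<le> (\<integral>x. \<bar>f x\<bar> \<partial>lebesgue_on {c..d})"
    by (rule integral_abs_bound)
  also have "\<dots> = integral {c..d} (\<lambda>x. \<bar>f x\<bar>)"
    by (rule lebesgue_integral_eq_integral[OF abs']) auto
  also have "\<dots> \<le> integral {a..b} (\<lambda>x. \<bar>f x\<bar>)"
    using abs abs' sub by (intro integral_subset_le) (auto intro!: integrable_on_lebesgue_on)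
  also have "\<dots> = (\<integral>x. \<bar>f x\<bar> \<partial>lebesgue_on {a..b})"
    by (rule lebesgue_integral_eq_integral[OF abs, symmetric]) auto
  finally show ?thesis .
qed

text \<open>Norm convergence on the whole interval controls the integral over every subinterval.
  This allows series converging in L2 to be integrated termwise up to a variable end point.\<close>

lemma tendsto_L2_integral_subinterval:
  assumes v: "L2_on a b v" and S: "\<And>n. L2_on a b (S n)"
    and lim: "(\<lambda>n. L2_norm a b (\<lambda>x. v x - S n x)) \<longlonglongrightarrow> 0"
    and sub: "{c..d} \<subseteq> {a..b}" and "a \<le> b"
  shows "(\<lambda>n. \<integral>x. S n x \<partial>lebesgue_on {c..d}) \<longlonglongrightarrow> (\<integral>x. v x \<partial>lebesgue_on {c..d})"
proof -
  let ?M = "lebesgue_on {c..d}"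
  have "(\<lambda>n. (\<integral>x. v x \<partial>?M) - (\<integral>x. S n x \<partial>?M)) \<longlonglongrightarrow> 0"
  proof (rule Lim_null_comparison)
    show "\<forall>\<^sub>F n in sequentially. norm ((\<integral>x. v x \<partial>?M) - (\<integral>x. S n x \<partial>?M))
        \<le> sqrt (b - a) * L2_norm a b (\<lambda>x. v x - S n x)"
    proof (intro always_eventually allI)
      fix n
      note D = L2_on_diff[OF v S[of n]]
      have "(\<integral>x. v x \<partial>?M) - (\<integral>x. S n x \<partial>?M) = (\<integral>x. (v x - S n x) \<partial>?M)"
        by (simp add: integrable_subinterval[OF L2_on_integrable[OF v] sub]
            integrable_subinterval[OF L2_on_integrable[OF S] sub])
      then show "norm ((\<integral>x. v x \<partial>?M) - (\<integral>x. S n x \<partial>?M))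
          \<le> sqrt (b - a) * L2_norm a b (\<lambda>x. v x - S n x)"
        using order_trans[OF integral_subinterval_abs_le[OF L2_on_integrable[OF D] sub]
            L2_integral_abs_le[OF D \<open>a \<le> b\<close>]] by simp
    qed
    show "(\<lambda>n. sqrt (b - a) * L2_norm a b (\<lambda>x. v x - S n x)) \<longlonglongrightarrow> 0"
      using tendsto_mult[OF tendsto_const lim] by simp
  qed
  from tendsto_diff[OF tendsto_const[of "\<integral>x. v x \<partial>?M"] this] show ?thesis by simp
qed

lemma lebesgue_integral_FTC:
  fixes f F :: "real \<Rightarrow> real"
  assumes "a \<le> b" "continuous_on {a..b} f"
    and "\<And>x. x \<in> {a..b} \<Longrightarrow> (F has_real_derivative f x) (at x within {a..b})"
  shows "(\<integral>x. f x \<partial>lebesgue_on {a..b}) = F b - F a"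
proof -
  have "(f has_integral (F b - F a)) {a..b}"
    using assms by (intro fundamental_theorem_of_calculus)
      (auto simp: has_real_derivative_iff_has_vector_derivative)
  moreover have "(f has_integral (\<integral>x. f x \<partial>lebesgue_on {a..b})) {a..b}"
    by (intro has_integral_integral_lebesgue_on continuous_imp_integrable_real assms) auto
  ultimately show ?thesis
    by (metis has_integral_unique)
qed

section \<open>The conjugate series\<close>

text \<open>An integer \<open>j\<close> admits the differences of indices that come out of
  product-to-sum formulas; for \<open>j \<noteq> 0\<close> the antiderivative vanishes at both
  ends.\<close>

lemma integral_cos_even:
  fixes j :: int
  shows "(\<integral>x. cos (2 * of_int j * x) \<partial>lebesgue_on {0..pi/2}) = (if j = 0 then pi/2 else 0)"
proof (cases "j = 0")
  case True
  then show ?thesis by (simp add: measure_restrict_space)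
next
  case False
  have "(\<integral>x. cos (2 * of_int j * x) \<partial>lebesgue_on {0..pi/2})
    = sin (2 * of_int j * (pi/2)) / (2 * of_int j) - sin (2 * of_int j * 0) / (2 * of_int j)"
    by (rule lebesgue_integral_FTC)
      (use False in \<open>auto intro!: continuous_intros derivative_eq_intros\<close>)
  then show ?thesis using False by (simp add: sin_npi_int mult.commute)
qed

text \<open>Sums and differences of two frequencies \<open>2k + q\<close> are even, so the
  product-to-sum formula reduces to \<open>integral_cos_even\<close>. The condition
  \<open>q \<ge> 1\<close> keeps the sum of two frequencies positive.\<close>

lemma orthogonal_system_sin:
  assumes "q \<ge> 1"
  shows "orthogonal_system 0 (pi/2) (pi/4) (\<lambda>k x. sin (real (2 * k + q) * x))"
  unfolding orthogonal_system_def
proof (intro conjI allI)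
  fix j k
  have [simp]: "integrable (lebesgue_on {0..pi/2}) (\<lambda>x. cos (2 * of_int l * x))" for l
    by (intro continuous_imp_integrable_real continuous_intros)
  have "(\<integral>x. sin (real (2 * j + q) * x) * sin (real (2 * k + q) * x) \<partial>lebesgue_on {0..pi/2})
    = (\<integral>x. (cos (2 * of_int (int j - int k) * x) - cos (2 * of_int (int j + int k + int q) * x)) / 2
        \<partial>lebesgue_on {0..pi/2})"
    by (rule Bochner_Integration.integral_cong) (auto simp: sin_times_sin algebra_simps)
  also have "\<dots> = ((if int j - int k = 0 then pi/2 else 0) - (if int j + int k + int q = 0 then pi/2 else 0)) / 2"
    by (simp only: integral_divide_zero Bochner_Integration.integral_diff integral_cos_even
        \<open>\<And>l. integrable (lebesgue_on {0..pi/2}) (\<lambda>x. cos (2 * of_int l * x))\<close>)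
  also have "\<dots> = (if j = k then pi/4 else 0)" using assms by auto
  finally show "(\<integral>x. sin (real (2 * j + q) * x) * sin (real (2 * k + q) * x) \<partial>lebesgue_on {0..pi/2})
    = (if j = k then pi/4 else 0)" .
qed (intro continuous_imp_L2_on continuous_intros)

text \<open>As for the sines; with \<open>q = 0\<close> the constant member would have squared norm
  \<open>pi/2\<close> instead.\<close>

lemma orthogonal_system_cos:
  assumes "q \<ge> 1"
  shows "orthogonal_system 0 (pi/2) (pi/4) (\<lambda>k x. cos (real (2 * k + q) * x))"
  unfolding orthogonal_system_def
proof (intro conjI allI)
  fix j k
  have [simp]: "integrable (lebesgue_on {0..pi/2}) (\<lambda>x. cos (2 * of_int l * x))" for l
    by (intro continuous_imp_integrable_real continuous_intros)
  have "(\<integral>x. cos (real (2 * j + q) * x) * cos (real (2 * k + q) * x) \<partial>lebesgue_on {0..pi/2})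
    = (\<integral>x. (cos (2 * of_int (int j - int k) * x) + cos (2 * of_int (int j + int k + int q) * x)) / 2
        \<partial>lebesgue_on {0..pi/2})"
    by (rule Bochner_Integration.integral_cong) (auto simp: cos_times_cos algebra_simps)
  also have "\<dots> = ((if int j - int k = 0 then pi/2 else 0) + (if int j + int k + int q = 0 then pi/2 else 0)) / 2"
    by (simp only: integral_divide_zero Bochner_Integration.integral_add integral_cos_even
        \<open>\<And>l. integrable (lebesgue_on {0..pi/2}) (\<lambda>x. cos (2 * of_int l * x))\<close>)
  also have "\<dots> = (if j = k then pi/4 else 0)" using assms by auto
  finally show "(\<integral>x. cos (real (2 * j + q) * x) * cos (real (2 * k + q) * x) \<partial>lebesgue_on {0..pi/2})
    = (if j = k then pi/4 else 0)" .
qed (intro continuous_imp_L2_on continuous_intros)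

text \<open>Both conjugations are covered by one family of frequencies \<open>2k + q\<close>: \<open>q = 2\<close> for \<open>\<zeta>\<close> and \<open>q = 1\<close> for \<open>(\<tau>' sin)'\<close>.
  With \<open>q = 0\<close> the zeroth coefficient vanishes, which makes it the index shift of \<open>q = 2\<close>.\<close>

definition sine_coeff :: "nat \<Rightarrow> (real \<Rightarrow> real) \<Rightarrow> nat \<Rightarrow> real" where
  "sine_coeff q w k = 4 / pi * (\<integral>x. w x * sin (real (2 * k + q) * x) \<partial>lebesgue_on {0..pi/2})"

text \<open>\<open>v\<close> is the cosine series with the sine coefficients of \<open>w\<close>.
  Bessel's inequality for the sines makes these square summable and bounds the norm of
  \<open>v\<close>, as both systems have the same squared norms. The integrated series will identify
  \<open>v\<close> as a derivative; the limit almost everywhere allows products to be formed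
  pointwise.\<close>

lemma L2_conjugate:
  assumes w: "L2_on 0 (pi/2) w" and q: "q \<ge> 1"
  obtains v r where "L2_on 0 (pi/2) v" "L2_norm 0 (pi/2) v \<le> L2_norm 0 (pi/2) w"
    "(\<lambda>n. L2_norm 0 (pi/2) (\<lambda>x. v x - (\<Sum>k<n. sine_coeff q w k * cos (real (2 * k + q) * x)))) \<longlonglongrightarrow> 0"
    "strict_mono (r :: nat \<Rightarrow> nat)"
    "AE x in lebesgue_on {0..pi/2}. (\<lambda>n. \<Sum>k<r n. sine_coeff q w k * cos (real (2 * k + q) * x)) \<longlonglongrightarrow> v x"
    "sine_coeff q w \<longlonglongrightarrow> 0"
    "\<And>\<sigma>. \<sigma> \<in> {0..pi/2} \<Longrightarrow> (\<lambda>k. sine_coeff q w k * sin (real (2 * k + q) * \<sigma>) / real (2 * k + q))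
        sums (\<integral>x. v x \<partial>lebesgue_on {0..\<sigma>})"
proof -
  let ?M = "lebesgue_on {0..pi/2}"
  let ?b = "sine_coeff q w"
  let ?S = "\<lambda>n x. \<Sum>k<n. ?b k * cos (real (2 * k + q) * x)"
  note os = orthogonal_system_sin[OF q] and oc = orthogonal_system_cos[OF q]
  have Bessel: "pi/4 * (\<Sum>k<n. (?b k)\<^sup>2) \<le> (\<integral>x. (w x)\<^sup>2 \<partial>?M)" for n
    by (rule Bessel_inequality[OF os w]) (auto simp: sine_coeff_def)
  have summ: "summable (\<lambda>k. (?b k)\<^sup>2)"
  proof (rule summableI_nonneg_bounded)
    show "(\<Sum>k<n. (?b k)\<^sup>2) \<le> (\<integral>x. (w x)\<^sup>2 \<partial>?M) / (pi/4)" for n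
      using Bessel[of n] by (simp add: field_simps)
  qed auto
  obtain v r where v: "L2_on 0 (pi/2) v"
    and lim: "(\<lambda>n. L2_norm 0 (pi/2) (\<lambda>x. v x - ?S n x)) \<longlonglongrightarrow> 0"
    and r: "strict_mono (r :: nat \<Rightarrow> nat)" "AE x in ?M. (\<lambda>n. ?S (r n) x) \<longlonglongrightarrow> v x"
    using Riesz_Fischer[OF oc _ _ summ] by (auto simp: pi_ge_zero)
  have SL: "L2_on 0 (pi/2) (?S n)" for n by (rule orthogonal_sum_L2_on[OF oc])
  have "L2_norm 0 (pi/2) v \<le> L2_norm 0 (pi/2) w"
  proof (rule LIMSEQ_le_const)
    show "(\<lambda>n. L2_norm 0 (pi/2) (\<lambda>x. v x - ?S n x) + L2_norm 0 (pi/2) w) \<longlonglongrightarrow> L2_norm 0 (pi/2) w"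
      using tendsto_add[OF lim tendsto_const] by simp
    have "L2_norm 0 (pi/2) (?S n) \<le> L2_norm 0 (pi/2) w" for n
      unfolding L2_norm_def orthogonal_sum_power2[OF oc] by (intro real_sqrt_le_mono Bessel)
    moreover have "L2_norm 0 (pi/2) v \<le> L2_norm 0 (pi/2) (\<lambda>x. v x - ?S n x) + L2_norm 0 (pi/2) (?S n)" for n
      using L2_norm_triangle[OF L2_on_diff[OF v SL[of n]] SL[of n]] by simp
    ultimately show "\<exists>N. \<forall>n\<ge>N. L2_norm 0 (pi/2) v \<le> L2_norm 0 (pi/2) (\<lambda>x. v x - ?S n x) + L2_norm 0 (pi/2) w"
      by (meson add_left_mono order_trans)
  qed
  \<comment> \<open>The squares are the terms of a convergent series; the square root turns them
    into absolute values.\<close>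
  moreover have "?b \<longlonglongrightarrow> 0"
    using tendsto_real_sqrt[OF summable_LIMSEQ_zero[OF summ]] by (simp add: tendsto_rabs_zero_iff)
  moreover have "(\<lambda>k. ?b k * sin (real (2 * k + q) * \<sigma>) / real (2 * k + q))
        sums (\<integral>x. v x \<partial>lebesgue_on {0..\<sigma>})" if \<sigma>: "\<sigma> \<in> {0..pi/2}" for \<sigma>
  proof -
    have "(\<integral>x. ?S n x \<partial>lebesgue_on {0..\<sigma>}) = (\<Sum>k<n. ?b k * sin (real (2 * k + q) * \<sigma>) / real (2 * k + q))" for n
    proof -
      have "(\<integral>x. ?S n x \<partial>lebesgue_on {0..\<sigma>})
        = (\<Sum>k<n. ?b k * sin (real (2 * k + q) * \<sigma>) / real (2 * k + q))
          - (\<Sum>k<n. ?b k * sin (real (2 * k + q) * 0) / real (2 * k + q))"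
        by (rule lebesgue_integral_FTC)
          (use \<sigma> q in \<open>auto intro!: continuous_intros derivative_eq_intros sum.cong\<close>)
      then show ?thesis by simp
    qed
    then show ?thesis
      using tendsto_L2_integral_subinterval[OF v SL lim, of 0 \<sigma>] \<sigma> by (simp add: sums_def)
  qed
  ultimately show thesis using that[OF v _ lim r] by blast
qed

section \<open>Expansion of the kernel\<close>

text \<open>Multiplying the partial sums by \<open>1 - z\<close> leaves a series that converges uniformly on the closed disc, so
  the identity extends from the open disc by continuity.\<close>

lemma ln_series_boundary:
  fixes z :: complex
  assumes "cmod z = 1" "z \<noteq> 1"
  shows "(\<lambda>n. z ^ Suc n / of_nat (Suc n)) sums (- ln (1 - z))"
proof -
  \<comment> \<open>\<open>A\<close> collects what is left after multiplying by
    \<open>1 - z\<close>: its coefficient is the difference of \<open>1/(n+1)\<close> and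
    \<open>1/(n+2)\<close>, hence absolutely summable on the closed disc.\<close>
  define A where "A = (\<lambda>n z::complex. z ^ (n + 2) / (of_nat (n + 1) * of_nat (n + 2)))"
  define F where "F = (\<lambda>z. \<Sum>n. A n z)"
  have M: "cmod (A n z) \<le> inverse (real (Suc n) ^ 2)" if "z \<in> cball 0 1" for n z
  proof -
    have "cmod (A n z) = cmod z ^ (n + 2) / (real (n + 1) * real (n + 2))"
      unfolding A_def norm_divide norm_mult norm_power norm_of_nat ..
    also have "\<dots> \<le> 1 / (real (Suc n) * real (Suc n))"
      using that by (intro frac_le mult_mono power_le_one) auto
    finally show ?thesis by (simp add: power2_eq_square divide_simps)
  qed
  have summM: "summable (\<lambda>n. inverse (real (Suc n) ^ 2))"
    using inverse_power_summable[of 2, where 'a = real] summable_Suc_iff[of "\<lambda>n. inverse (real n ^ 2)"]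
    by simp
  have "uniform_limit (cball 0 1) (\<lambda>n z. \<Sum>i<n. A i z) F sequentially"
    unfolding F_def by (rule Weierstrass_m_test[OF M summM])
  then have contF: "continuous_on (cball 0 1) F"
  proof (rule uniform_limit_theorem[rotated])
    have "continuous_on (cball 0 1) (A n)" for n
      unfolding A_def by (intro continuous_intros) (simp only: of_nat_eq_0_iff mult_eq_0_iff, simp)
    then show "\<forall>\<^sub>F n in sequentially. continuous_on (cball 0 1) (\<lambda>z. \<Sum>i<n. A i z)"
      by (intro always_eventually allI continuous_on_sum)
  qed simp
  have sumsA: "(\<lambda>n. A n z) sums F z" if "z \<in> cball 0 1" for z
    unfolding F_def using summable_comparison_test'[OF summM, of 0 "\<lambda>n. A n z"] M[OF that]
    by (auto intro!: summable_sums)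
  \<comment> \<open>Summation by parts; the last summand is the boundary term, which tends to zero
    on the closed disc.\<close>
  have partial: "(1 - z) * (\<Sum>n<Suc m. z ^ Suc n / of_nat (Suc n))
      = z - (\<Sum>n<m. A n z) - z ^ (m + 2) / of_nat (m + 1)" for m and z :: complex
  proof (induction m)
    case 0
    show ?case by (simp add: algebra_simps power2_eq_square)
  next
    case (Suc m)
    have [simp]: "(of_nat (m + 1) :: complex) \<noteq> 0" "(of_nat (m + 2) :: complex) \<noteq> 0"
      by (simp_all only: of_nat_eq_0_iff)
    have A: "A m z = z ^ (m + 2) / of_nat (m + 1) - z ^ (m + 2) / of_nat (m + 2)"
    proof -
      have "z ^ (m + 2) / of_nat (m + 1) - z ^ (m + 2) / of_nat (m + 2)
        = z ^ (m + 2) * (of_nat (m + 2) - of_nat (m + 1)) / (of_nat (m + 1) * of_nat (m + 2))"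
        by (simp only: diff_frac_eq[OF \<open>of_nat (m + 1) \<noteq> 0\<close> \<open>of_nat (m + 2) \<noteq> 0\<close>] right_diff_distrib)
      then show ?thesis by (simp add: A_def)
    qed
    have "(1 - z) * (\<Sum>n<Suc (Suc m). z ^ Suc n / of_nat (Suc n))
      = (1 - z) * (\<Sum>n<Suc m. z ^ Suc n / of_nat (Suc n)) + (1 - z) * (z ^ (m + 2) / of_nat (m + 2))"
      by (simp add: distrib_left)
    also have "\<dots> = z - (\<Sum>n<m. A n z) - A m z - z ^ (m + 3) / of_nat (m + 2)"
      unfolding Suc.IH A by (simp add: algebra_simps power_add eval_nat_numeral diff_divide_distrib)
    finally show ?case by (simp add: eval_nat_numeral)
  qed
  have sums: "(\<lambda>n. z ^ Suc n / of_nat (Suc n)) sums ((z - F z) / (1 - z))"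
    if z: "z \<in> cball 0 1" "z \<noteq> 1" for z
  proof -
    have "(\<lambda>m. z ^ (m + 2) / of_nat (m + 1)) \<longlonglongrightarrow> 0"
    proof (rule Lim_null_comparison)
      show "\<forall>\<^sub>F m in sequentially. norm (z ^ (m + 2) / of_nat (m + 1)) \<le> 1 / real (Suc m)"
        using z by (intro always_eventually allI)
          (auto simp only: norm_divide norm_power norm_of_nat Suc_eq_plus1 intro!: divide_right_mono power_le_one, auto)
      show "(\<lambda>m. 1 / real (Suc m)) \<longlonglongrightarrow> 0"
        using LIMSEQ_inverse_real_of_nat by (simp add: inverse_eq_divide)
    qed
    then have "(\<lambda>m. z - (\<Sum>n<m. A n z) - z ^ (m + 2) / of_nat (m + 1)) \<longlonglongrightarrow> z - F z - 0"
      using sumsA[OF z(1)] by (intro tendsto_intros) (auto simp: sums_def)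
    then have "(\<lambda>m. (1 - z) * (\<Sum>n<Suc m. z ^ Suc n / of_nat (Suc n))) \<longlonglongrightarrow> z - F z"
      by (simp only: partial diff_zero)
    then have "(\<lambda>m. (1 - z) * (\<Sum>n<Suc m. z ^ Suc n / of_nat (Suc n)) / (1 - z)) \<longlonglongrightarrow> (z - F z) / (1 - z)"
      using z(2) by (intro tendsto_divide tendsto_const) auto
    then have "(\<lambda>m. \<Sum>n<Suc m. z ^ Suc n / of_nat (Suc n)) \<longlonglongrightarrow> (z - F z) / (1 - z)"
      using z(2) by simp
    then show ?thesis unfolding sums_def by (rule LIMSEQ_imp_Suc)
  qed
  have inner: "(z - F z) / (1 - z) = - ln (1 - z)" if z: "cmod z < 1" for z
  proof -
    \<comment> \<open>The double negation fits \<open>Ln_series'\<close>, which expands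
      \<open>ln (1 + w)\<close>, to \<open>w = - z\<close>.\<close>
    have "(\<lambda>n. - ((- (- z)) ^ n) / of_nat n) sums ln (1 + (- z))"
      by (rule Ln_series') (use z in simp)
    then have "(\<lambda>n. z ^ n / of_nat n) sums (- ln (1 - z))"
      using sums_minus by fastforce
    then have "(\<lambda>n. z ^ Suc n / of_nat (Suc n)) sums (- ln (1 - z))"
      using sums_Suc_iff[of "\<lambda>n. z ^ n / of_nat n" "- ln (1 - z)"] by simp
    then show ?thesis
      using sums[of z] z sums_unique2 by force
  qed
  \<comment> \<open>A radial approach to \<open>z\<close> from inside the disc.\<close>
  define y where "y = (\<lambda>n. of_real (1 - 1 / real (Suc n)) * z)"
  have y: "y \<longlonglongrightarrow> z"
  proof -
    have "(\<lambda>n. complex_of_real (1 - 1 / real (Suc n)) * z) \<longlonglongrightarrow> of_real (1 - 0) * z"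
      using LIMSEQ_inverse_real_of_nat by (intro tendsto_intros) (simp add: inverse_eq_divide)
    then show ?thesis by (simp add: y_def)
  qed
  have yn: "cmod (y n) < 1" for n
    using assms by (auto simp: y_def norm_mult abs_if simp del: of_real_diff of_nat_Suc)
  \<comment> \<open>Then \<open>1 - z\<close> has positive real part, so it lies off the branch cut
    and \<open>ln\<close> is continuous there.\<close>
  have Re: "Re z < 1"
  proof (rule ccontr)
    assume "\<not> Re z < 1"
    then have "Re z = 1" using complex_Re_le_cmod[of z] assms by simp
    then have "Im z = 0" using assms(1) cmod_power2[of z] by simp
    then show False using \<open>Re z = 1\<close> assms(2) by (simp add: complex_eq_iff)
  qed
  have "(\<lambda>n. F (y n)) \<longlonglongrightarrow> F z"
    by (rule continuous_on_tendsto_compose[OF contF y]) (use assms yn in \<open>auto simp: less_imp_le\<close>)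
  then have "(\<lambda>n. (y n - F (y n)) / (1 - y n)) \<longlonglongrightarrow> (z - F z) / (1 - z)"
    using y assms(2) by (intro tendsto_intros) auto
  moreover have "(\<lambda>n. - ln (1 - y n)) \<longlonglongrightarrow> - ln (1 - z)"
    using Re by (intro tendsto_intros y) (auto simp: complex_nonpos_Reals_iff)
  ultimately have "(z - F z) / (1 - z) = - ln (1 - z)"
    using inner[OF yn] LIMSEQ_unique by fastforce
  then show ?thesis using sums[of z] assms by simp
qed

text \<open>This is the real part of the boundary logarithm series at \<open>cis (2 * x)\<close>,
  because the modulus of \<open>1 - cis (2 * x)\<close> is twice the absolute value of
  \<open>sin x\<close>.\<close>

lemma cos_series_ln_sin:
  assumes "sin x \<noteq> 0"
  shows "(\<lambda>k. cos (real (2 * k + 2) * x) / real (k + 1)) sums (- ln \<bar>2 * sin x\<bar>)"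
proof -
  define z where "z = cis (2 * x)"
  have norm: "cmod (1 - z) = \<bar>2 * sin x\<bar>"
  proof -
    have "(cmod (1 - z))\<^sup>2 = (1 - cos (2 * x))\<^sup>2 + (sin (2 * x))\<^sup>2"
      by (simp add: cmod_power2 z_def)
    also have "\<dots> = (2 * sin x)\<^sup>2"
      using sin_cos_squared_add[of "2 * x"] cos_double_sin[of x] 
      by (simp add: power2_eq_square algebra_simps)
    finally show ?thesis by (metis norm_ge_zero power2_abs abs_ge_zero power2_eq_iff_nonneg)
  qed
  then have "z \<noteq> 1" using assms by auto
  have "(\<lambda>n. z ^ Suc n / of_nat (Suc n)) sums (- ln (1 - z))"
    by (rule ln_series_boundary) (use \<open>z \<noteq> 1\<close> in \<open>auto simp: z_def\<close>)
  then have "(\<lambda>n. Re (z ^ Suc n / of_nat (Suc n))) sums Re (- ln (1 - z))"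
    by (rule sums_Re)
  moreover have "Re (z ^ Suc n / of_nat (Suc n)) = cos (real (2 * n + 2) * x) / real (n + 1)" for n
  proof -
    have "z ^ Suc n = cis (real (Suc n) * (2 * x))" unfolding z_def by (rule Complex.DeMoivre)
    then have "Re (z ^ Suc n / of_nat (Suc n)) = cos (real (Suc n) * (2 * x)) / real (Suc n)"
      by (simp only: Re_divide_of_nat cis.sel)
    then show ?thesis by (simp add: algebra_simps)
  qed
  moreover have "Re (- ln (1 - z)) = - ln \<bar>2 * sin x\<bar>"
    using \<open>z \<noteq> 1\<close> norm by simp
  ultimately show ?thesis by simp
qed

text \<open>Subtract the log-sine series at \<open>s + \<sigma>\<close> from the one at
  \<open>s - \<sigma>\<close>: the terms \<open>ln 2\<close> cancel, and the differences of cosines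
  become products of sines.\<close>

lemma K_ker_series:
  assumes "s \<in> {0..pi/2}" "\<sigma> \<in> {0..pi/2}" "s \<noteq> \<sigma>"
  shows "(\<lambda>k. 2 * sin (real (2 * k + 2) * \<sigma>) / real (k + 1) * sin (real (2 * k + 2) * s)) sums K_ker s \<sigma>"
proof -
  have nz: "sin (s - \<sigma>) \<noteq> 0" "sin (s + \<sigma>) \<noteq> 0"
  proof -
    have "sin (s + \<sigma>) > 0" using assms by (intro sin_gt_zero) auto
    then show "sin (s + \<sigma>) \<noteq> 0" by simp
    \<comment> \<open>The absolute value places the argument in the positive range, whichever of the
      two points is larger.\<close>
    have "sin \<bar>s - \<sigma>\<bar> > 0" using assms by (intro sin_gt_zero) auto
    then show "sin (s - \<sigma>) \<noteq> 0" using sin_minus[of "s - \<sigma>"] by (auto simp: abs_if split: if_splits)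
  qed
  from sums_diff[OF cos_series_ln_sin[OF nz(1)] cos_series_ln_sin[OF nz(2)]]
  have "(\<lambda>k. cos (real (2 * k + 2) * (s - \<sigma>)) / real (k + 1) - cos (real (2 * k + 2) * (s + \<sigma>)) / real (k + 1))
      sums (- ln \<bar>2 * sin (s - \<sigma>)\<bar> - - ln \<bar>2 * sin (s + \<sigma>)\<bar>)" .
  moreover have "- ln \<bar>2 * sin (s - \<sigma>)\<bar> - - ln \<bar>2 * sin (s + \<sigma>)\<bar> = K_ker s \<sigma>"
    using nz by (simp add: K_ker_def abs_mult ln_mult ln_div)
  moreover have "cos (real (2 * k + 2) * (s - \<sigma>)) / real (k + 1) - cos (real (2 * k + 2) * (s + \<sigma>)) / real (k + 1)
    = 2 * sin (real (2 * k + 2) * \<sigma>) / real (k + 1) * sin (real (2 * k + 2) * s)" for k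
    unfolding right_diff_distrib distrib_left cos_add cos_diff
    by (simp add: algebra_simps del: of_nat_add of_nat_mult of_nat_Suc flip: diff_divide_distrib add_divide_distrib)
  ultimately show ?thesis by simp
qed

text \<open>For fixed \<open>\<sigma>\<close> the coefficients \<open>d\<close> of the kernel are
  square summable, so its sine series has an L2 limit \<open>v\<close>. Its pointwise sum is the
  kernel, hence \<open>v\<close> equals the kernel almost everywhere, and pairing the series with
  \<open>w\<close> gives the expansion.\<close>

lemma H_op_sums:
  assumes w: "L2_on 0 (pi/2) w" and \<sigma>: "\<sigma> \<in> {0..pi/2}"
  shows "(\<lambda>k. sine_coeff 2 w k * sin (real (2 * k + 2) * \<sigma>) / real (2 * k + 2)) sums H_op w \<sigma>"
proof -
  let ?M = "lebesgue_on {0..pi/2}"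
  define d where "d = (\<lambda>k. 2 * sin (real (2 * k + 2) * \<sigma>) / real (k + 1))"
  have summ: "summable (\<lambda>k. (d k)\<^sup>2)"
  proof (rule summable_comparison_test'[where N = 0])
    show "summable (\<lambda>k. 4 * inverse (real (Suc k) ^ 2))"
      using inverse_power_summable[of 2, where 'a = real] summable_Suc_iff[of "\<lambda>n. inverse (real n ^ 2)"]
      by (intro summable_mult) simp
    show "norm ((d k)\<^sup>2) \<le> 4 * inverse (real (Suc k) ^ 2)" for k
      by (simp add: d_def power_divide power_mult_distrib divide_simps abs_square_le_1 
          del: of_nat_Suc of_nat_add of_nat_mult)
  qed
  let ?S = "\<lambda>n x. \<Sum>k<n. d k * sin (real (2 * k + 2) * x)"
  have os: "orthogonal_system 0 (pi/2) (pi/4) (\<lambda>k x. sin (real (2 * k + 2) * x))"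
    by (rule orthogonal_system_sin) simp
  obtain v r where v: "L2_on 0 (pi/2) v"
    and lim: "(\<lambda>n. L2_norm 0 (pi/2) (\<lambda>x. v x - ?S n x)) \<longlonglongrightarrow> 0"
    and r: "strict_mono (r :: nat \<Rightarrow> nat)" "AE x in ?M. (\<lambda>n. ?S (r n) x) \<longlonglongrightarrow> v x"
    using Riesz_Fischer[OF os _ _ summ] by (auto simp: pi_ge_zero)
  have SL: "L2_on 0 (pi/2) (?S n)" for n by (rule orthogonal_sum_L2_on[OF os])
  \<comment> \<open>The singularity of the kernel sits at a single point.\<close>
  have "AE x in ?M. x \<noteq> \<sigma>" by (rule AE_lebesgue_on_neq)
  moreover have "AE x in ?M. x \<in> {0..pi/2}" by (rule AE_I2) simp
  ultimately have AEK: "AE x in ?M. K_ker x \<sigma> * w x = v x * w x"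
    using r(2)
  proof eventually_elim
    case (elim x)
    have "(\<lambda>n. ?S n x) \<longlonglongrightarrow> K_ker x \<sigma>"
      using K_ker_series[of x \<sigma>] elim \<sigma> by (simp add: sums_def d_def)
    then have "(\<lambda>n. ?S (r n) x) \<longlonglongrightarrow> K_ker x \<sigma>"
      using r(1) LIMSEQ_subseq_LIMSEQ[of "\<lambda>n. ?S n x" _ r] by (simp add: o_def)
    from LIMSEQ_unique[OF this elim(3)] show ?case by simp
  qed
  have "(\<integral>x. K_ker x \<sigma> * w x \<partial>?M) = (\<integral>x. w x * v x \<partial>?M)"
  proof -
    note [measurable] = L2_onD(1)[OF w] L2_onD(1)[OF v]
    have "(\<lambda>x. K_ker x \<sigma>) \<in> borel_measurable ?M"
    proof -
      have "(\<lambda>x. K_ker x \<sigma>) \<in> borel_measurable borel" unfolding K_ker_def by measurable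
      then have "(\<lambda>x. K_ker x \<sigma>) \<in> borel_measurable lborel" by simp
      then have "(\<lambda>x. K_ker x \<sigma>) \<in> borel_measurable lebesgue" by (rule measurable_completion)
      then show ?thesis by (rule measurable_restrict_space1)
    qed
    note [measurable] = this
    show ?thesis
      by (rule integral_cong_AE) (use AEK in \<open>auto simp: mult.commute\<close>)
  qed
  moreover have "(\<lambda>n. \<integral>x. w x * ?S n x \<partial>?M) \<longlonglongrightarrow> (\<integral>x. w x * v x \<partial>?M)"
    by (rule tendsto_L2_integral_mult[OF w v SL lim])
  ultimately have "(\<lambda>n. 1 / pi * (\<Sum>k<n. d k * (\<integral>x. w x * sin (real (2 * k + 2) * x) \<partial>?M))) \<longlonglongrightarrow> H_op w \<sigma>"
    unfolding orthogonal_sum_mult[OF os w] H_op_def by (intro tendsto_mult) simp_all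
  moreover have "1 / pi * (\<Sum>k<n. d k * (\<integral>x. w x * sin (real (2 * k + 2) * x) \<partial>?M))
    = (\<Sum>k<n. sine_coeff 2 w k * sin (real (2 * k + 2) * \<sigma>) / real (2 * k + 2))" for n
    unfolding sum_distrib_left
  proof (intro sum.cong refl)
    fix k
    \<comment> \<open>The \<open>1/pi\<close> of \<open>H_op\<close> and the \<open>2\<close> of the
      kernel series combine to the \<open>4/pi\<close> of \<open>sine_coeff\<close> over the doubled
      denominator.\<close>
    have "1 / pi * (2 * X / c * I) = 4 / pi * I * X / (2 * c)" for X c I :: real by simp
    moreover have "real (2 * k + 2) = 2 * real (k + 1)" by simp
    ultimately show "1 / pi * (d k * (\<integral>x. w x * sin (real (2 * k + 2) * x) \<partial>?M))
      = sine_coeff 2 w k * sin (real (2 * k + 2) * \<sigma>) / real (2 * k + 2)"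
      unfolding d_def sine_coeff_def by metis
  qed
  ultimately show ?thesis by (simp add: sums_def)
qed

section \<open>Indefinite integrals\<close>

lemma integral_lebesgue_on_eq_integral:
  fixes h :: "real \<Rightarrow> real"
  assumes "integrable (lebesgue_on {a..b}) h" "a \<le> x" "y \<le> b"
  shows "(\<integral>t. h t \<partial>lebesgue_on {x..y}) = integral {x..y} h"
  by (rule lebesgue_integral_eq_integral[OF integrable_subinterval[OF assms(1)]]) (use assms in auto)

lemma lebesgue_integral_combine:
  fixes h :: "real \<Rightarrow> real"
  assumes h: "integrable (lebesgue_on {a..b}) h" and "a \<le> x" "x \<le> y" "y \<le> b"
  shows "(\<integral>t. h t \<partial>lebesgue_on {a..y}) = (\<integral>t. h t \<partial>lebesgue_on {a..x}) + (\<integral>t. h t \<partial>lebesgue_on {x..y})"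
proof -
  have "h integrable_on {a..y}"
    by (rule integrable_on_lebesgue_on[OF integrable_subinterval[OF h]]) (use assms in auto)
  from Henstock_Kurzweil_Integration.integral_combine[OF \<open>a \<le> x\<close> \<open>x \<le> y\<close> this]
  show ?thesis using assms by (simp add: integral_lebesgue_on_eq_integral[OF h])
qed

lemma integrable_mult_continuous:
  fixes h \<phi> :: "real \<Rightarrow> real"
  assumes h: "integrable (lebesgue_on {a..b}) h" and c: "continuous_on {a..b} \<phi>"
  shows "integrable (lebesgue_on {a..b}) (\<lambda>x. h x * \<phi> x)"
proof -
  have "compact (\<phi> ` {a..b})"
    by (intro compact_continuous_image c compact_Icc)
  then obtain B where B: "\<And>x. x \<in> {a..b} \<Longrightarrow> \<bar>\<phi> x\<bar> \<le> B"
    by (meson bounded_real compact_imp_bounded imageI)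
  have [measurable]: "\<phi> \<in> borel_measurable (lebesgue_on {a..b})"
    by (rule continuous_imp_measurable_on_sets_lebesgue[OF c]) auto
  show ?thesis
  proof (rule Bochner_Integration.integrable_bound)
    show "integrable (lebesgue_on {a..b}) (\<lambda>x. B * h x)" using h by simp
    show "AE x in lebesgue_on {a..b}. norm (h x * \<phi> x) \<le> norm (B * h x)"
    proof (rule AE_I2)
      fix x assume "x \<in> space (lebesgue_on {a..b})"
      then have "\<bar>\<phi> x\<bar> \<le> \<bar>B\<bar>" using B by fastforce
      then show "norm (h x * \<phi> x) \<le> norm (B * h x)"
        by (simp add: abs_mult mult.commute mult_right_mono)
    qed
    show "(\<lambda>x. h x * \<phi> x) \<in> borel_measurable (lebesgue_on {a..b})"
      using borel_measurable_integrable[OF h] by measurable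
  qed
qed

text \<open>The two sides, as functions of the upper end point, differ by a function whose increment over \<open>[x,y]\<close> is at
  most a constant times \<open>(y - x) \<integral>\<^sub>x\<^sup>y |h|\<close>, hence by a function with zero derivative.\<close>

lemma integral_by_parts_AC:
  fixes F h \<phi> \<phi>' :: "real \<Rightarrow> real"
  assumes "a \<le> b" and h: "integrable (lebesgue_on {a..b}) h"
    and F: "\<And>x. x \<in> {a..b} \<Longrightarrow> F x = F a + (\<integral>t. h t \<partial>lebesgue_on {a..x})"
    and \<phi>: "\<And>x. x \<in> {a..b} \<Longrightarrow> (\<phi> has_real_derivative \<phi>' x) (at x within {a..b})"
    and \<phi>': "continuous_on {a..b} \<phi>'"
  shows "(\<integral>x. h x * \<phi> x \<partial>lebesgue_on {a..b}) + (\<integral>x. F x * \<phi>' x \<partial>lebesgue_on {a..b})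
    = F b * \<phi> b - F a * \<phi> a"
proof -
  \<comment> \<open>\<open>N\<close> measures the variation of \<open>F\<close>: it bounds the
    increments of \<open>F\<close> and is continuous.\<close>
  define N where "N = (\<lambda>x. integral {a..x} (\<lambda>t. \<bar>h t\<bar>))"
  define g where "g = (\<lambda>t. h t * \<phi> t + F t * \<phi>' t)"
  \<comment> \<open>The claim amounts to \<open>G\<close> having the same value at \<open>a\<close>
    and \<open>b\<close>.\<close>
  define G where "G = (\<lambda>x. F x * \<phi> x - integral {a..x} g)"
  have c\<phi>: "continuous_on {a..b} \<phi>"
    using \<phi> by (meson DERIV_continuous continuous_on_eq_continuous_within)
  have cF: "continuous_on {a..b} F"
    using indefinite_integral_continuous_real[OF h]
    by (subst continuous_on_cong[OF refl F]) (auto intro!: continuous_intros)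
  have ah: "integrable (lebesgue_on {a..b}) (\<lambda>t. \<bar>h t\<bar>)" using h by simp
  have h\<phi>: "integrable (lebesgue_on {a..b}) (\<lambda>t. h t * \<phi> t)"
    by (rule integrable_mult_continuous[OF h c\<phi>])
  have F\<phi>': "integrable (lebesgue_on {a..b}) (\<lambda>t. F t * \<phi>' t)"
    by (intro continuous_imp_integrable_real continuous_intros cF \<phi>')
  have io: "f integrable_on {x..y}" if "integrable (lebesgue_on {a..b}) f" "a \<le> x" "y \<le> b"
    for f :: "real \<Rightarrow> real" and x y
    by (rule integrable_on_lebesgue_on[OF integrable_subinterval[OF that(1)]]) (use that in auto)
  have gi: "integrable (lebesgue_on {a..b}) g" unfolding g_def using h\<phi> F\<phi>' by simp
  have cN: "continuous_on {a..b} N"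
    unfolding N_def by (intro indefinite_integral_continuous_1 io ah) auto
  have "compact (\<phi>' ` {a..b})" by (intro compact_continuous_image \<phi>' compact_Icc)
  then obtain B where B: "\<And>x. x \<in> {a..b} \<Longrightarrow> \<bar>\<phi>' x\<bar> \<le> B"
    by (meson bounded_real compact_imp_bounded imageI)
  have B0: "0 \<le> B" using B[of a] \<open>a \<le> b\<close> by fastforce
  have Fdiff: "F y - F x = integral {x..y} h" if "a \<le> x" "x \<le> y" "y \<le> b" for x y
    using F[of x] F[of y] lebesgue_integral_combine[OF h, of x y] that
    by (simp add: integral_lebesgue_on_eq_integral[OF h])
  have Ndiff: "N y - N x = integral {x..y} (\<lambda>t. \<bar>h t\<bar>)" if "a \<le> x" "x \<le> y" "y \<le> b" for x y
    unfolding N_def using Henstock_Kurzweil_Integration.integral_combine[OF that(1,2) io[OF ah]] that by simp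
  have Nmono: "N x \<le> N y" if "a \<le> x" "x \<le> y" "y \<le> b" for x y
    using Ndiff[OF that] Henstock_Kurzweil_Integration.integral_nonneg[OF io[OF ah, of x y]] that by simp
  have \<phi>diff: "(\<phi>' has_integral (\<phi> y - \<phi> x)) {x..y}" if "a \<le> x" "x \<le> y" "y \<le> b" for x y
    using \<phi> that by (intro fundamental_theorem_of_calculus)
      (auto simp flip: has_real_derivative_iff_has_vector_derivative intro!: DERIV_subset[OF \<phi>])
  have key: "\<bar>G y - G x\<bar> \<le> 2 * B * (y - x) * (N y - N x)" if xy: "a \<le> x" "x \<le> y" "y \<le> b" for x y
  proof -
    \<comment> \<open>An integrand for \<open>G y - G x\<close>. It regroups as
      \<open>h t * (\<phi> y - \<phi> t) + (F x - F t) * \<phi>' t\<close>; the first summand is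
      small by the bound \<open>B\<close> on \<open>\<phi>'\<close>, the second by the increment of
      \<open>N\<close>.\<close>
    let ?k = "\<lambda>t. h t * \<phi> y + F x * \<phi>' t - g t"
    have hi: "(h has_integral (F y - F x)) {x..y}"
      using Fdiff[OF xy] io[OF h] xy by (metis integrable_integral)
    have "(g has_integral (integral {a..y} g - integral {a..x} g)) {x..y}"
      using Henstock_Kurzweil_Integration.integral_combine[OF xy(1,2) io[OF gi]] io[OF gi, of x y] xy
      by (metis add_diff_cancel_left' integrable_integral order_refl)
    then have "(?k has_integral ((F y - F x) * \<phi> y + F x * (\<phi> y - \<phi> x) - (integral {a..y} g - integral {a..x} g))) {x..y}"
      by (intro has_integral_diff has_integral_add has_integral_mult_left has_integral_mult_right hi \<phi>diff xy)
    also have "(F y - F x) * \<phi> y + F x * (\<phi> y - \<phi> x) - (integral {a..y} g - integral {a..x} g) = G y - G x"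
      by (simp add: G_def algebra_simps)
    finally have k: "(?k has_integral (G y - G x)) {x..y}" .
    have bnd: "((\<lambda>t. B * (y - x) * \<bar>h t\<bar> + B * (N y - N x)) has_integral
        (B * (y - x) * (N y - N x) + (y - x) * (B * (N y - N x)))) {x..y}"
    proof (intro has_integral_add has_integral_mult_right)
      show "((\<lambda>t. \<bar>h t\<bar>) has_integral (N y - N x)) {x..y}"
        using Ndiff[OF xy] io[OF ah] xy by (metis integrable_integral)
      show "((\<lambda>t. B * (N y - N x)) has_integral ((y - x) * (B * (N y - N x)))) {x..y}"
        using has_integral_const_real[of "B * (N y - N x)" x y] xy by simp
    qed
    have "norm (G y - G x) \<le> B * (y - x) * (N y - N x) + (y - x) * (B * (N y - N x))"
    proof (rule has_integral_norm_bound_integral_component[OF k bnd, of 1, unfolded inner_real_def mult.right_neutral])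
      fix t assume t: "t \<in> {x..y}"
      have "\<bar>\<phi> y - \<phi> t\<bar> \<le> B * (y - t)"
        using has_integral_norm_bound_integral_component[OF \<phi>diff[of t y] has_integral_const_real[of B t y], of 1] B t xy
        by (simp add: mult.commute)
      also have "\<dots> \<le> B * (y - x)" using B0 t by (intro mult_left_mono) auto
      finally have 1: "\<bar>h t * (\<phi> y - \<phi> t)\<bar> \<le> B * (y - x) * \<bar>h t\<bar>"
        by (simp add: abs_mult mult.commute mult_left_mono)
      have "\<bar>F t - F x\<bar> \<le> N t - N x"
      proof -
        have "\<bar>integral {x..t} h\<bar> \<le> integral {x..t} (\<lambda>t. \<bar>h t\<bar>)"
          using integral_norm_bound_integral[OF io[OF h] io[OF ah], of x t] t xy by simp
        then show ?thesis using Fdiff[of x t] Ndiff[of x t] t xy by auto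
      qed
      also have "\<dots> \<le> N y - N x" using Nmono[of t y] t xy by auto
      finally have 2: "\<bar>(F x - F t) * \<phi>' t\<bar> \<le> B * (N y - N x)"
        unfolding abs_mult mult.commute[of B] using B[of t] t xy B0
        by (intro mult_mono) (auto simp: abs_minus_commute)
      have "?k t = h t * (\<phi> y - \<phi> t) + (F x - F t) * \<phi>' t"
        by (simp add: g_def algebra_simps)
      then show "norm (?k t) \<le> B * (y - x) * \<bar>h t\<bar> + B * (N y - N x)"
        using 1 2 by simp
    qed
    then show ?thesis by (simp add: algebra_simps)
  qed
  have sym: "\<bar>G y - G x\<bar> \<le> 2 * B * \<bar>y - x\<bar> * \<bar>N y - N x\<bar>" if "x \<in> {a..b}" "y \<in> {a..b}" for x y
  proof (cases "x \<le> y")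
    case True
    then show ?thesis using key[of x y] Nmono[of x y] that by simp
  next
    case False
    then show ?thesis using key[of y x] Nmono[of y x] that by (simp add: abs_minus_commute)
  qed
  \<comment> \<open>Dividing the estimate by \<open>y - x\<close> leaves an increment of
    \<open>N\<close>, which tends to zero by continuity even where \<open>F\<close> has no
    derivative.\<close>
  have "(G has_real_derivative 0) (at x within {a..b})" if x: "x \<in> {a..b}" for x
    unfolding has_field_derivative_iff
  proof (rule Lim_null_comparison)
    show "\<forall>\<^sub>F y in at x within {a..b}. norm ((G y - G x) / (y - x)) \<le> 2 * B * \<bar>N y - N x\<bar>"
      unfolding eventually_at_filter
    proof (intro always_eventually allI impI)
      fix y assume "y \<noteq> x" "y \<in> {a..b}"
      then show "norm ((G y - G x) / (y - x)) \<le> 2 * B * \<bar>N y - N x\<bar>"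
        using sym[OF x, of y] by (simp add: divide_le_eq mult_ac)
    qed
    have "(N \<longlongrightarrow> N x) (at x within {a..b})"
      using cN x by (auto simp: continuous_on_def)
    from tendsto_mult[OF tendsto_const[of "2 * B"] tendsto_rabs[OF tendsto_diff[OF this tendsto_const[of "N x"]]]]
    show "((\<lambda>y. 2 * B * \<bar>N y - N x\<bar>) \<longlongrightarrow> 0) (at x within {a..b})" by simp
  qed
  then obtain c where "\<And>x. x \<in> {a..b} \<Longrightarrow> G x = c"
    using has_field_derivative_zero_constant[of "{a..b}" G] by auto
  then have "G b = G a" using \<open>a \<le> b\<close> by auto
  then have "integral {a..b} g = F b * \<phi> b - F a * \<phi> a" by (simp add: G_def)
  moreover have "integral {a..b} g = (\<integral>x. g x \<partial>lebesgue_on {a..b})"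
    using gi by (intro lebesgue_integral_eq_integral[symmetric]) auto
  ultimately show ?thesis using h\<phi> F\<phi>' by (simp add: g_def)
qed

section \<open>Weak derivatives of absolutely continuous functions\<close>

lemma integrable_imp_loc_integrable:
  assumes "integrable (lebesgue_on {a..b}) f"
  shows "loc_integrable a b f"
  unfolding loc_integrable_def
proof (intro allI impI)
  fix K assume K: "compact K \<and> K \<subseteq> {a<..<b}"
  have "set_integrable lebesgue {a..b} f"
    using assms by (simp add: integrable_restrict_space set_integrable_def)
  then have "set_integrable lebesgue K f"
  proof (rule set_integrable_subset)
    show "K \<in> sets lebesgue" using K by (auto intro: lmeasurable_compact fmeasurableD)
    show "K \<subseteq> {a..b}" using K greaterThanLessThan_subseteq_atLeastAtMost_iff by (auto dest!: subsetD)
  qed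
  moreover have "K \<in> sets lebesgue" using K by (auto intro: lmeasurable_compact fmeasurableD)
  ultimately show "integrable (lebesgue_on K) f"
    by (simp add: integrable_restrict_space set_integrable_def)
qed

text \<open>Integration by parts against a test function, which vanishes at both ends. Equality of
  \<open>f\<close> and \<open>F\<close> is asked for only almost everywhere, because the conjugate
  function times \<open>sin\<close> is identified only in that sense.\<close>

lemma weak_deriv_AC:
  assumes "a < b" and h: "integrable (lebesgue_on {a..b}) h"
    and F: "\<And>x. x \<in> {a..b} \<Longrightarrow> F x = F a + (\<integral>t. h t \<partial>lebesgue_on {a..x})"
    and f: "integrable (lebesgue_on {a..b}) f"
    and ae: "AE x in lebesgue_on {a..b}. f x = F x"
  shows "weak_deriv a b f h"
  unfolding weak_deriv_def
proof (intro conjI allI impI integrable_imp_loc_integrable f h)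
  fix \<phi> assume "test_fun a b \<phi>"
  then have sm: "smooth_fun \<phi>" and supp: "closure {x. \<phi> x \<noteq> 0} \<subseteq> {a<..<b}"
    by (auto simp: test_fun_def)
  have "\<phi> differentiable_on UNIV" "deriv \<phi> differentiable_on UNIV"
    using sm[unfolded smooth_fun_def, rule_format, of 0] sm[unfolded smooth_fun_def, rule_format, of 1] by auto
  then have c: "continuous_on UNIV (deriv \<phi>)" and "\<phi> differentiable at x" for x
    by (auto simp: differentiable_on_def intro: differentiable_imp_continuous_on)
  then have der: "(\<phi> has_real_derivative deriv \<phi> x) (at x)" for x
    by (simp add: DERIV_deriv_iff_real_differentiable)
  have 0: "\<phi> a = 0" "\<phi> b = 0"
    using supp closure_subset[of "{x. \<phi> x \<noteq> 0}"] by fastforce+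
  have cF: "continuous_on {a..b} F"
    using indefinite_integral_continuous_real[OF h]
    by (subst continuous_on_cong[OF refl F]) (auto intro!: continuous_intros)
  have "(\<integral>x. h x * \<phi> x \<partial>lebesgue_on {a..b}) + (\<integral>x. F x * deriv \<phi> x \<partial>lebesgue_on {a..b})
    = F b * \<phi> b - F a * \<phi> a"
    by (rule integral_by_parts_AC[OF _ h F])
      (use \<open>a < b\<close> der c in \<open>auto intro: has_field_derivative_at_within continuous_on_subset\<close>)
  moreover have "(\<integral>x. f x * deriv \<phi> x \<partial>lebesgue_on {a..b}) = (\<integral>x. F x * deriv \<phi> x \<partial>lebesgue_on {a..b})"
  proof (rule integral_cong_AE)
    have [measurable]: "F \<in> borel_measurable (lebesgue_on {a..b})"
      "deriv \<phi> \<in> borel_measurable (lebesgue_on {a..b})"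
      by (auto intro!: continuous_imp_measurable_on_sets_lebesgue cF continuous_on_subset[OF c])
    note [measurable] = borel_measurable_integrable[OF f]
    show "(\<lambda>x. f x * deriv \<phi> x) \<in> borel_measurable (lebesgue_on {a..b})"
      "(\<lambda>x. F x * deriv \<phi> x) \<in> borel_measurable (lebesgue_on {a..b})" by measurable
    show "AE x in lebesgue_on {a..b}. f x * deriv \<phi> x = F x * deriv \<phi> x"
      using ae by eventually_elim simp
  qed
  ultimately show "(\<integral>x. f x * deriv \<phi> x \<partial>lebesgue_on {a..b}) = - (\<integral>x. h x * \<phi> x \<partial>lebesgue_on {a..b})"
    using 0 by simp
qed

section \<open>Hoelder regularity away from the origin\<close>

lemma L2_on_subinterval:
  assumes "L2_on a b h" "{x..y} \<subseteq> {a..b}"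
  shows "L2_on x y h"
  unfolding L2_on_def
  using integrable_subinterval[OF L2_onD(2)[OF assms(1)] assms(2)]
    integrable_subinterval[OF L2_on_integrable[OF assms(1)] assms(2)] by auto

lemma L2_norm_subinterval:
  assumes "L2_on a b h" "{x..y} \<subseteq> {a..b}"
  shows "L2_norm x y h \<le> L2_norm a b h"
  unfolding L2_norm_def using integral_subinterval_abs_le[OF L2_onD(2)[OF assms(1)] assms(2)]
  by (intro real_sqrt_le_mono) simp

text \<open>Cauchy-Schwarz on the short interval is the source of the Hoelder exponent one
  half.\<close>

lemma L2_integral_Holder:
  assumes h: "L2_on a b h" and sub: "{x..y} \<subseteq> {a..b}" and "x \<le> y"
  shows "\<bar>\<integral>t. h t \<partial>lebesgue_on {x..y}\<bar> \<le> sqrt (y - x) * L2_norm a b h"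
proof -
  have "\<bar>\<integral>t. h t \<partial>lebesgue_on {x..y}\<bar> \<le> (\<integral>t. \<bar>h t\<bar> \<partial>lebesgue_on {x..y})"
    by (rule integral_abs_bound)
  also have "\<dots> \<le> sqrt (y - x) * L2_norm x y h"
    by (rule L2_integral_abs_le[OF L2_on_subinterval[OF h sub] \<open>x \<le> y\<close>])
  also have "L2_norm x y h \<le> L2_norm a b h"
    by (rule L2_norm_subinterval[OF h sub])
  finally show ?thesis using \<open>x \<le> y\<close> by (simp add: mult_left_mono)
qed

lemma abs_sin_diff_le: "\<bar>sin x - sin y\<bar> \<le> \<bar>x - y\<bar>" for x y :: real
proof -
  have "\<bar>sin x - sin y\<bar> = 2 * \<bar>sin ((x - y) / 2)\<bar> * \<bar>cos ((x + y) / 2)\<bar>"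
    by (simp add: sin_diff_sin abs_mult)
  also have "\<dots> \<le> 2 * \<bar>(x - y) / 2\<bar> * 1"
    by (intro mult_mono abs_sin_x_le_abs_x) auto
  finally show ?thesis by simp
qed

text \<open>Serves both \<open>\<tau>\<close> and \<open>\<theta>\<close>, with \<open>p\<close> the
  derivative of \<open>f\<close> and \<open>P\<close> the continuous version of
  \<open>p * sin\<close>. As \<open>p\<close> equals \<open>P / sin\<close> only almost everywhere,
  the latter is the classical derivative. Away from zero it inherits exponent one half from
  \<open>P\<close>, since \<open>1 / sin\<close> is Lipschitz there.\<close>

lemma C1_half_div_sin:
  assumes h: "L2_on 0 (pi/2) h"
    and P: "\<And>x. x \<in> {0..pi/2} \<Longrightarrow> P x = P 0 + (\<integral>t. h t \<partial>lebesgue_on {0..x})"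
    and p: "integrable (lebesgue_on {0..pi/2}) p"
    and ae: "AE x in lebesgue_on {0..pi/2}. p x = P x / sin x"
    and f: "\<And>x. x \<in> {0..pi/2} \<Longrightarrow> f x = f 0 + (\<integral>t. p t \<partial>lebesgue_on {0..x})"
    and \<delta>: "\<delta> \<in> {0<..<pi/2}"
  shows "C1_half \<delta> (pi/2) f"
proof -
  have cP: "continuous_on {0..pi/2} P"
    using indefinite_integral_continuous_real[OF L2_on_integrable[OF h]]
    by (subst continuous_on_cong[OF refl P]) (auto intro!: continuous_intros)
  have "compact (P ` {0..pi/2})" by (intro compact_continuous_image cP compact_Icc)
  then obtain B where B: "\<And>x. x \<in> {0..pi/2} \<Longrightarrow> \<bar>P x\<bar> \<le> B"
    by (meson bounded_real compact_imp_bounded imageI)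
  have B0: "0 \<le> B" using B[of 0] by fastforce
  show ?thesis
    unfolding C1_half_def
  proof (intro exI conjI ballI)
    let ?W = "\<lambda>x. P x / sin x"
    have sinpos: "0 < sin \<delta>" using \<delta> by (intro sin_gt_zero) auto
    have sin: "sin \<delta> \<le> sin x" if "x \<in> {\<delta>..pi/2}" for x
      using that \<delta> by (intro sin_mono_le_eq[THEN iffD2]) auto
    have cW: "continuous_on {\<delta>..pi/2} ?W"
      using \<delta> sin sinpos by (intro continuous_intros continuous_on_subset[OF cP]) force+
    \<comment> \<open>Stated over \<open>lebesgue\<close> so that it can be restricted again to
      \<open>{\<delta>..x}\<close>.\<close>
    have AEl: "AE x in lebesgue. x \<in> {0..pi/2} \<longrightarrow> p x = P x / sin x"
      using ae by (subst (asm) AE_restrict_space_iff) auto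
    have eq: "f x = f \<delta> + integral {\<delta>..x} ?W" if x: "x \<in> {\<delta>..pi/2}" for x
    proof -
      have px: "integrable (lebesgue_on {\<delta>..x}) p"
        by (rule integrable_subinterval[OF p]) (use x \<delta> in auto)
      have cx: "continuous_on {\<delta>..x} ?W"
        by (rule continuous_on_subset[OF cW]) (use x in auto)
      have "f x = f \<delta> + (\<integral>t. p t \<partial>lebesgue_on {\<delta>..x})"
        using f[of x] f[of \<delta>] lebesgue_integral_combine[OF p, of \<delta> x] x \<delta> by auto
      also have "(\<integral>t. p t \<partial>lebesgue_on {\<delta>..x}) = (\<integral>t. ?W t \<partial>lebesgue_on {\<delta>..x})"
      proof (rule integral_cong_AE)
        show "p \<in> borel_measurable (lebesgue_on {\<delta>..x})" using px by auto
        show "?W \<in> borel_measurable (lebesgue_on {\<delta>..x})"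
          by (rule continuous_imp_measurable_on_sets_lebesgue[OF cx]) auto
        show "AE t in lebesgue_on {\<delta>..x}. p t = ?W t"
          using AEl x \<delta> by (subst AE_restrict_space_iff) (auto elim!: eventually_mono)
      qed
      also have "\<dots> = integral {\<delta>..x} ?W"
        by (intro lebesgue_integral_eq_integral continuous_imp_integrable_real cx) auto
      finally show ?thesis .
    qed
    show "(f has_real_derivative ?W x) (at x within {\<delta>..pi/2})" if x: "x \<in> {\<delta>..pi/2}" for x
    proof (rule has_field_derivative_transform_within[OF _ zero_less_one x])
      show "((\<lambda>x. f \<delta> + integral {\<delta>..x} ?W) has_real_derivative ?W x) (at x within {\<delta>..pi/2})"
        using integral_has_real_derivative[OF cW x] by (auto intro!: derivative_eq_intros)
    qed (rule eq[symmetric])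
    let ?L = "L2_norm 0 (pi/2) h"
    let ?s = "sin \<delta>"
    fix x y assume x: "x \<in> {\<delta>..pi/2}" and y: "y \<in> {\<delta>..pi/2}"
    have HP: "\<bar>P u - P v\<bar> \<le> sqrt \<bar>u - v\<bar> * ?L" if "u \<in> {\<delta>..pi/2}" "v \<in> {\<delta>..pi/2}" "v \<le> u" for u v
      using L2_integral_Holder[OF h, of v u] P[of u] P[of v] that \<delta>
        lebesgue_integral_combine[OF L2_on_integrable[OF h], of v u] by auto
    have HPxy: "\<bar>P x - P y\<bar> \<le> sqrt \<bar>x - y\<bar> * ?L"
      using HP[of x y] HP[of y x] x y by (cases "y \<le> x") (auto simp: abs_minus_commute)
    have sx: "?s \<le> sin x" and sy: "?s \<le> sin y" using sin x y by auto
    have t1: "\<bar>(P x - P y) / sin x\<bar> \<le> (sqrt \<bar>x - y\<bar> * ?L) / ?s"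
      unfolding abs_divide using HPxy sx sinpos by (intro frac_le) auto
    \<comment> \<open>Turns a Lipschitz bound into a Hoelder bound: distances in the interval are at
      most \<open>4\<close>, so their square roots are at most \<open>2\<close>.\<close>
    have d: "\<bar>x - y\<bar> \<le> 2 * sqrt \<bar>x - y\<bar>"
    proof -
      have "\<bar>x - y\<bar> = sqrt \<bar>x - y\<bar> * sqrt \<bar>x - y\<bar>" by simp
      also have "\<dots> \<le> 2 * sqrt \<bar>x - y\<bar>"
      proof (rule mult_right_mono)
        have "\<bar>x - y\<bar> \<le> 4" using x y \<delta> pi_less_4 by auto
        then show "sqrt \<bar>x - y\<bar> \<le> 2" by (intro real_le_lsqrt) auto
      qed simp
      finally show ?thesis .
    qed
    have "\<bar>P y * (sin y - sin x)\<bar> \<le> B * (2 * sqrt \<bar>x - y\<bar>)"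
      unfolding abs_mult
    proof (intro mult_mono)
      show "\<bar>P y\<bar> \<le> B" using B y \<delta> by auto
      show "\<bar>sin y - sin x\<bar> \<le> 2 * sqrt \<bar>x - y\<bar>"
        using abs_sin_diff_le[of y x] d by (simp add: abs_minus_commute)
    qed (use B0 in auto)
    then have t2: "\<bar>P y * (sin y - sin x) / (sin x * sin y)\<bar> \<le> B * (2 * sqrt \<bar>x - y\<bar>) / (?s * ?s)"
      unfolding abs_divide using sx sy sinpos B0 by (intro frac_le) (auto intro!: mult_mono simp: abs_mult)
    \<comment> \<open>Inserting \<open>P y / sin x\<close> separates the variation of
      \<open>P\<close> from that of \<open>1 / sin\<close>.\<close>
    have "?W x - ?W y = (P x - P y) / sin x + P y * (sin y - sin x) / (sin x * sin y)"
      using sx sy sinpos by (simp add: field_simps)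
    then have "\<bar>?W x - ?W y\<bar> \<le> (sqrt \<bar>x - y\<bar> * ?L) / ?s + B * (2 * sqrt \<bar>x - y\<bar>) / (?s * ?s)"
      by (simp only: order_trans[OF abs_triangle_ineq add_mono[OF t1 t2]])
    also have "\<dots> = (?L / ?s + 2 * B / (?s * ?s)) * \<bar>x - y\<bar> powr (1/2)"
      by (simp add: powr_half_sqrt algebra_simps)
    finally show "\<bar>?W x - ?W y\<bar> \<le> (?L / ?s + 2 * B / (?s * ?s)) * \<bar>x - y\<bar> powr (1/2)" .
  qed
qed

section \<open>The solution\<close>

text \<open>Each product of cosine and sine is half a difference of neighbouring sines of odd
  frequency, and summation by parts moves the difference onto the coefficients.
  \<open>\<beta> 0 = 0\<close> removes the boundary term at the lower end; the one at the upper end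
  disappears in the limit when \<open>\<beta>\<close> tends to zero.\<close>

lemma sin_multiplier_telescope:
  fixes \<beta> :: "nat \<Rightarrow> real"
  assumes "\<beta> 0 = 0"
  shows "(\<Sum>j<n. \<beta> (Suc j) * cos (real (2 * j + 2) * x)) * sin x
    = (\<Sum>k<n. (\<beta> k - \<beta> (Suc k)) / 2 * sin (real (2 * k + 1) * x)) + \<beta> n / 2 * sin (real (2 * n + 1) * x)"
proof (induction n)
  case 0
  then show ?case using assms by simp
next
  case (Suc n)
  have cs: "cos (real (2 * n + 2) * x) * sin x = (sin (real (2 * n + 3) * x) - sin (real (2 * n + 1) * x)) / 2"
    unfolding cos_times_sin by (simp add: algebra_simps)
  have "(\<Sum>j<Suc n. \<beta> (Suc j) * cos (real (2 * j + 2) * x)) * sin x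
    = (\<Sum>j<n. \<beta> (Suc j) * cos (real (2 * j + 2) * x)) * sin x + \<beta> (Suc n) * (cos (real (2 * n + 2) * x) * sin x)"
    by (simp add: distrib_right)
  also have "\<dots> = (\<Sum>k<n. (\<beta> k - \<beta> (Suc k)) / 2 * sin (real (2 * k + 1) * x))
      + \<beta> n / 2 * sin (real (2 * n + 1) * x)
      + \<beta> (Suc n) * ((sin (real (2 * n + 3) * x) - sin (real (2 * n + 1) * x)) / 2)"
    unfolding Suc cs ..
  also have "\<dots> = (\<Sum>k<Suc n. (\<beta> k - \<beta> (Suc k)) / 2 * sin (real (2 * k + 1) * x))
      + \<beta> (Suc n) / 2 * sin (real (2 * Suc n + 1) * x)"
    by (simp add: algebra_simps diff_divide_distrib)
  finally show ?case .
qed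

text \<open>Integration by parts turns the sine coefficients of \<open>G\<close> into cosine
  integrals of \<open>\<zeta> * sin\<close>, which are differences of neighbouring coefficients of
  \<open>\<zeta>\<close>. \<open>sin_multiplier_telescope\<close> produces the same differences for
  \<open>V * sin\<close>, so this function is the primitive of the conjugate \<open>h\<close> of
  \<open>G\<close>.\<close>

lemma conjugate_times_sin:
  assumes \<zeta>: "L2_on 0 (pi/2) \<zeta>"
    and r: "strict_mono (r :: nat \<Rightarrow> nat)"
    and V: "AE x in lebesgue_on {0..pi/2}. (\<lambda>n. \<Sum>k<r n. sine_coeff 2 \<zeta> k * cos (real (2 * k + 2) * x)) \<longlonglongrightarrow> V x"
    and coeff0: "sine_coeff 2 \<zeta> \<longlonglongrightarrow> 0"
    and G: "L2_on 0 (pi/2) G"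
    and U: "\<And>x. x \<in> {0..pi/2} \<Longrightarrow> U x = U 0 + (\<integral>t. G t \<partial>lebesgue_on {0..x})"
    and U1: "U (pi/2) = 0"
    and U\<zeta>: "AE x in lebesgue_on {0..pi/2}. U x = \<zeta> x * sin x"
  obtains h where "L2_on 0 (pi/2) h" "L2_norm 0 (pi/2) h \<le> L2_norm 0 (pi/2) G"
    "AE x in lebesgue_on {0..pi/2}. V x * sin x = (\<integral>t. h t \<partial>lebesgue_on {0..x})"
proof -
  let ?M = "lebesgue_on {0..pi/2}"
  define \<beta> where "\<beta> = sine_coeff 0 \<zeta>"
  have \<beta>0: "\<beta> 0 = 0" by (simp add: \<beta>_def sine_coeff_def)
  have \<beta>Suc: "\<beta> (Suc k) = sine_coeff 2 \<zeta> k" for k by (simp add: \<beta>_def sine_coeff_def)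
  have \<beta>lim: "\<beta> \<longlonglongrightarrow> 0"
    using coeff0 unfolding \<beta>Suc[symmetric, abs_def] by (rule LIMSEQ_imp_Suc)
  obtain h r' where h: "L2_on 0 (pi/2) h" "L2_norm 0 (pi/2) h \<le> L2_norm 0 (pi/2) G"
    and hs: "\<And>\<sigma>. \<sigma> \<in> {0..pi/2} \<Longrightarrow> (\<lambda>k. sine_coeff 1 G k * sin (real (2 * k + 1) * \<sigma>) / real (2 * k + 1))
        sums (\<integral>x. h x \<partial>lebesgue_on {0..\<sigma>})"
    by (rule L2_conjugate[OF G, of 1]) auto
  have cU: "continuous_on {0..pi/2} U"
    using indefinite_integral_continuous_real[OF L2_on_integrable[OF G]]
    by (subst continuous_on_cong[OF refl U]) (auto intro!: continuous_intros)
  have UL: "L2_on 0 (pi/2) U" by (rule continuous_imp_L2_on[OF cU])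
  have coeff: "sine_coeff 1 G k / real (2 * k + 1) = (\<beta> k - \<beta> (Suc k)) / 2" for k
  proof -
    let ?m = "real (2 * k + 1)"
    have [simp]: "integrable ?M (\<lambda>x. \<zeta> x * sin (c * x))" for c
      by (intro L2_on_integrable_mult \<zeta> continuous_imp_L2_on continuous_intros)
    \<comment> \<open>The boundary term at \<open>0\<close> vanishes with the sine; at
      \<open>pi/2\<close>, where the sine is \<open>1\<close> or \<open>-1\<close>, it vanishes
      because of \<open>U1\<close>.\<close>
    have "(\<integral>x. G x * sin (?m * x) \<partial>?M) + (\<integral>x. U x * (?m * cos (?m * x)) \<partial>?M)
        = U (pi/2) * sin (?m * (pi/2)) - U 0 * sin (?m * 0)"
      by (rule integral_by_parts_AC[OF _ L2_on_integrable[OF G] U])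
        (auto intro!: derivative_eq_intros continuous_intros simp: pi_ge_zero)
    then have "(\<integral>x. G x * sin (?m * x) \<partial>?M) = - (\<integral>x. ?m * (U x * cos (?m * x)) \<partial>?M)"
      using U1 by (simp add: mult_ac)
    also have "\<dots> = - (?m * (\<integral>x. U x * cos (?m * x) \<partial>?M))"
      by (simp only: integral_mult_right_zero)
    also have "(\<integral>x. U x * cos (?m * x) \<partial>?M)
        = (\<integral>x. (\<zeta> x * sin (real (2 * Suc k + 0) * x) - \<zeta> x * sin (real (2 * k + 0) * x)) / 2 \<partial>?M)"
    proof (rule integral_cong_AE)
      note [measurable] = L2_onD(1)[OF UL] L2_onD(1)[OF \<zeta>]
      have [measurable]: "(\<lambda>x. cos (c * x)) \<in> borel_measurable ?M" "(\<lambda>x. sin (c * x)) \<in> borel_measurable ?M" for c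
        by (auto intro!: continuous_imp_measurable_on_sets_lebesgue continuous_intros)
      show "(\<lambda>x. U x * cos (?m * x)) \<in> borel_measurable ?M"
        "(\<lambda>x. (\<zeta> x * sin (real (2 * Suc k + 0) * x) - \<zeta> x * sin (real (2 * k + 0) * x)) / 2) \<in> borel_measurable ?M"
        by measurable
      show "AE x in ?M. U x * cos (?m * x)
          = (\<zeta> x * sin (real (2 * Suc k + 0) * x) - \<zeta> x * sin (real (2 * k + 0) * x)) / 2"
        using U\<zeta>
      proof eventually_elim
        case (elim x)
        have "sin x * cos (?m * x) = (sin (real (2 * Suc k + 0) * x) - sin (real (2 * k + 0) * x)) / 2"
          unfolding mult.commute[of "sin x"] cos_times_sin by (simp add: algebra_simps)
        then show ?case using elim by (simp add: mult.assoc right_diff_distrib)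
      qed
    qed
    also have "\<dots> = ((\<integral>x. \<zeta> x * sin (real (2 * Suc k + 0) * x) \<partial>?M) - (\<integral>x. \<zeta> x * sin (real (2 * k + 0) * x) \<partial>?M)) / 2"
      by (simp only: integral_divide_zero Bochner_Integration.integral_diff
          \<open>\<And>c. integrable ?M (\<lambda>x. \<zeta> x * sin (c * x))\<close>)
    also have "\<dots> = pi / 4 * ((\<beta> (Suc k) - \<beta> k) / 2)"
      unfolding \<beta>_def sine_coeff_def by (simp add: field_simps)
    finally have "(\<integral>x. G x * sin (?m * x) \<partial>?M) = - (?m * (pi / 4 * ((\<beta> (Suc k) - \<beta> k) / 2)))" .
    then have "sine_coeff 1 G k = ?m * ((\<beta> k - \<beta> (Suc k)) / 2)"
      unfolding sine_coeff_def by (simp add: field_simps)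
    then show ?thesis by simp
  qed
  have "AE x in ?M. x \<in> {0..pi/2}" by (rule AE_I2) simp
  then have "AE x in ?M. V x * sin x = (\<integral>t. h t \<partial>lebesgue_on {0..x})"
    using V
  proof eventually_elim
    case (elim x)
    have "(\<lambda>n. \<Sum>k<n. (\<beta> k - \<beta> (Suc k)) / 2 * sin (real (2 * k + 1) * x)) \<longlonglongrightarrow> (\<integral>t. h t \<partial>lebesgue_on {0..x})"
      using hs[OF elim(1)] unfolding sums_def coeff[symmetric] by (simp add: mult_ac)
    moreover have "(\<lambda>n. \<beta> n / 2 * sin (real (2 * n + 1) * x)) \<longlonglongrightarrow> 0"
    proof (rule Lim_null_comparison)
      show "\<forall>\<^sub>F n in sequentially. norm (\<beta> n / 2 * sin (real (2 * n + 1) * x)) \<le> \<bar>\<beta> n\<bar>"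
      proof (intro always_eventually allI)
        fix n
        have "\<bar>\<beta> n / 2\<bar> * \<bar>sin (real (2 * n + 1) * x)\<bar> \<le> \<bar>\<beta> n\<bar> * 1"
          by (intro mult_mono) auto
        then show "norm (\<beta> n / 2 * sin (real (2 * n + 1) * x)) \<le> \<bar>\<beta> n\<bar>"
          by (simp only: real_norm_def abs_mult mult_1_right)
      qed
      show "(\<lambda>n. \<bar>\<beta> n\<bar>) \<longlonglongrightarrow> 0" using \<beta>lim by (rule tendsto_rabs_zero)
    qed
    ultimately have "(\<lambda>n. (\<Sum>j<n. \<beta> (Suc j) * cos (real (2 * j + 2) * x)) * sin x)
        \<longlonglongrightarrow> (\<integral>t. h t \<partial>lebesgue_on {0..x}) + 0"
      unfolding sin_multiplier_telescope[of \<beta>, OF \<beta>0] by (rule tendsto_add)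
    \<comment> \<open>\<open>V\<close> is available only as a limit along \<open>r\<close>, so the
      convergence of the full sequence is restricted to it.\<close>
    then have "(\<lambda>n. (\<Sum>j<r n. \<beta> (Suc j) * cos (real (2 * j + 2) * x)) * sin x)
        \<longlonglongrightarrow> (\<integral>t. h t \<partial>lebesgue_on {0..x})"
      using LIMSEQ_subseq_LIMSEQ[OF _ r] by (fastforce simp: o_def)
    moreover have "(\<lambda>n. (\<Sum>j<r n. \<beta> (Suc j) * cos (real (2 * j + 2) * x)) * sin x) \<longlonglongrightarrow> V x * sin x"
      unfolding \<beta>Suc by (intro tendsto_mult elim(2) tendsto_const)
    ultimately show ?case by (rule LIMSEQ_unique[rotated])
  qed
  with h show thesis by (rule that)
qed

text \<open>Here \<open>\<theta>\<close> is only known to be absolutely continuous; the formula is obtained from smooth approximations \<open>T n\<close>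
  whose derivatives converge in \<open>L\<^sup>2\<close>.\<close>

lemma chain_rule_limit:
  fixes S T :: "nat \<Rightarrow> real \<Rightarrow> real" and \<theta> v Z z :: "real \<Rightarrow> real"
  assumes "a \<le> b"
    and T: "\<And>n x. x \<in> {a..b} \<Longrightarrow> (T n has_real_derivative S n x) (at x within {a..b})"
    and S: "\<And>n. continuous_on {a..b} (S n)"
    and T\<theta>: "\<And>x. x \<in> {a..b} \<Longrightarrow> (\<lambda>n. T n x) \<longlonglongrightarrow> \<theta> x"
    and v: "L2_on a b v" and Sv: "(\<lambda>n. L2_norm a b (\<lambda>x. v x - S n x)) \<longlonglongrightarrow> 0"
    and \<theta>: "continuous_on {a..b} \<theta>"
    and Z: "\<And>x. x \<in> {a..b} \<Longrightarrow> (Z has_real_derivative z x) (at x within {a..b})"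
    and z: "continuous_on {a..b} z" and Z0: "\<And>x. x \<in> {a..b} \<Longrightarrow> 0 \<le> Z x"
  shows "(\<integral>x. exp (- Z x) * ((1 + v x) * cos (x + \<theta> x) * cos x - sin (x + \<theta> x) * sin x
      - z x * sin (x + \<theta> x) * cos x) \<partial>lebesgue_on {a..b})
    = sin (b + \<theta> b) * cos b * exp (- Z b) - sin (a + \<theta> a) * cos a * exp (- Z a)"
proof -
  let ?M = "lebesgue_on {a..b}"
  \<comment> \<open>The derivative of \<open>\<psi>\<close> when \<open>v\<close> is the derivative
    of \<open>\<theta>\<close>. Keeping the two as separate arguments permits replacing them one at
    a time.\<close>
  define g where "g = (\<lambda>\<theta> v x. exp (- Z x) * ((1 + v) * cos (x + \<theta>) * cos x - sin (x + \<theta>) * sin x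
      - z x * sin (x + \<theta>) * cos x))"
  define \<psi> where "\<psi> = (\<lambda>\<theta> x. sin (x + \<theta>) * cos x * exp (- Z x))"
  have cT: "continuous_on {a..b} (T n)" for n
    using T by (meson DERIV_continuous continuous_on_eq_continuous_within)
  have cZ: "continuous_on {a..b} Z"
    using Z by (meson DERIV_continuous continuous_on_eq_continuous_within)
  have cmeas: "f \<in> borel_measurable ?M" if "continuous_on {a..b} f" for f :: "real \<Rightarrow> real"
    by (rule continuous_imp_measurable_on_sets_lebesgue[OF that]) auto
  note [measurable] = cmeas[OF cT] cmeas[OF cZ] cmeas[OF \<theta>] cmeas[OF z] cmeas[OF S] L2_onD(1)[OF v]
  have [measurable]: "(\<lambda>x. x) \<in> borel_measurable ?M" by (intro cmeas continuous_intros)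
  have FTC: "(\<integral>x. g (T n x) (S n x) x \<partial>?M) = \<psi> (T n b) b - \<psi> (T n a) a" for n
  proof (rule lebesgue_integral_FTC[OF \<open>a \<le> b\<close>])
    show "continuous_on {a..b} (\<lambda>x. g (T n x) (S n x) x)"
      unfolding g_def by (intro continuous_intros cT S cZ z)
    show "((\<lambda>x. \<psi> (T n x) x) has_real_derivative g (T n x) (S n x) x) (at x within {a..b})"
      if "x \<in> {a..b}" for x
      unfolding \<psi>_def g_def using T[OF that, of n] Z[OF that]
      by (auto intro!: derivative_eq_intros simp: algebra_simps)
  qed
  have w: "integrable ?M (\<lambda>x. 2 + \<bar>v x\<bar> + \<bar>z x\<bar>)"
    using L2_on_integrable[OF v] continuous_imp_integrable_real[OF z] by simp
  \<comment> \<open>The bound is independent of \<open>t\<close>, so one integrable function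
    dominates for all \<open>n\<close>.\<close>
  have gb: "\<bar>g t u x\<bar> \<le> 2 + \<bar>u\<bar> + \<bar>z x\<bar>" if "x \<in> {a..b}" for t u x
  proof -
    have e: "exp (- Z x) \<le> 1" using Z0[OF that] by simp
    have sc: "\<bar>cos (x + t) * cos x\<bar> \<le> 1" "\<bar>sin (x + t) * sin x\<bar> \<le> 1" "\<bar>sin (x + t) * cos x\<bar> \<le> 1"
      by (simp_all add: abs_mult mult_le_one)
    have tri: "\<bar>A - B - C\<bar> \<le> p + 1 + q" if "\<bar>A\<bar> \<le> p" "\<bar>B\<bar> \<le> 1" "\<bar>C\<bar> \<le> q" for A B C p q :: real
      using that by linarith
    have "\<bar>(1 + u) * (cos (x + t) * cos x)\<bar> \<le> (1 + \<bar>u\<bar>) * 1"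
      unfolding abs_mult[of "1 + u"] by (intro mult_mono sc) auto
    moreover have "\<bar>z x * (sin (x + t) * cos x)\<bar> \<le> \<bar>z x\<bar> * 1"
      unfolding abs_mult[of "z x"] by (intro mult_mono sc) auto
    ultimately have "\<bar>(1 + u) * cos (x + t) * cos x - sin (x + t) * sin x - z x * sin (x + t) * cos x\<bar>
        \<le> (1 + \<bar>u\<bar>) * 1 + 1 + \<bar>z x\<bar> * 1"
      unfolding mult.assoc by (intro tri sc(2))
    also have "\<dots> = 2 + \<bar>u\<bar> + \<bar>z x\<bar>" by simp
    finally have "\<bar>(1 + u) * cos (x + t) * cos x - sin (x + t) * sin x - z x * sin (x + t) * cos x\<bar> \<le> 2 + \<bar>u\<bar> + \<bar>z x\<bar>" .
    then have "exp (- Z x) * \<bar>(1 + u) * cos (x + t) * cos x - sin (x + t) * sin x - z x * sin (x + t) * cos x\<bar>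
        \<le> 1 * (2 + \<bar>u\<bar> + \<bar>z x\<bar>)"
      using e by (intro mult_mono) auto
    then show ?thesis by (simp add: g_def abs_mult)
  qed
  have "(\<lambda>n. \<integral>x. g (T n x) (v x) x \<partial>?M) \<longlonglongrightarrow> (\<integral>x. g (\<theta> x) (v x) x \<partial>?M)"
  proof (rule integral_dominated_convergence[OF _ _ w])
    show "(\<lambda>x. g (\<theta> x) (v x) x) \<in> borel_measurable ?M" "(\<lambda>x. g (T n x) (v x) x) \<in> borel_measurable ?M" for n
      unfolding g_def by measurable
    show "AE x in ?M. (\<lambda>n. g (T n x) (v x) x) \<longlonglongrightarrow> g (\<theta> x) (v x) x"
      unfolding g_def by (rule AE_I2) (auto intro!: tendsto_intros T\<theta>)
    show "AE x in ?M. norm (g (T n x) (v x) x) \<le> 2 + \<bar>v x\<bar> + \<bar>z x\<bar>" for n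
      by (rule AE_I2) (auto intro!: gb)
  qed
  \<comment> \<open>Here \<open>S n\<close> is exchanged for \<open>v\<close> by norm convergence:
    \<open>g\<close> is affine in this argument, with slope of modulus at most one.\<close>
  moreover have "(\<lambda>n. (\<integral>x. g (T n x) (v x) x \<partial>?M) - (\<integral>x. g (T n x) (S n x) x \<partial>?M)) \<longlonglongrightarrow> 0"
  proof (rule Lim_null_comparison)
    show "(\<lambda>n. sqrt (b - a) * L2_norm a b (\<lambda>x. v x - S n x)) \<longlonglongrightarrow> 0"
      using tendsto_mult[OF tendsto_const Sv] by simp
    show "\<forall>\<^sub>F n in sequentially. norm ((\<integral>x. g (T n x) (v x) x \<partial>?M) - (\<integral>x. g (T n x) (S n x) x \<partial>?M))
        \<le> sqrt (b - a) * L2_norm a b (\<lambda>x. v x - S n x)"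
    proof (intro always_eventually allI)
      fix n
      have i1: "integrable ?M (\<lambda>x. g (T n x) (v x) x)"
      proof (rule Bochner_Integration.integrable_bound[OF w])
        show "AE x in ?M. norm (g (T n x) (v x) x) \<le> norm (2 + \<bar>v x\<bar> + \<bar>z x\<bar>)"
          using gb by (intro AE_I2) force
      qed (unfold g_def, measurable)
      have i2: "integrable ?M (\<lambda>x. g (T n x) (S n x) x)"
        unfolding g_def by (intro continuous_imp_integrable_real continuous_intros cT S cZ z)
      have D: "L2_on a b (\<lambda>x. v x - S n x)"
        by (intro L2_on_diff v continuous_imp_L2_on S)
      have "\<bar>(\<integral>x. g (T n x) (v x) x \<partial>?M) - (\<integral>x. g (T n x) (S n x) x \<partial>?M)\<bar>
        = \<bar>\<integral>x. g (T n x) (v x) x - g (T n x) (S n x) x \<partial>?M\<bar>"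
        using i1 i2 by simp
      also have "\<dots> \<le> (\<integral>x. \<bar>g (T n x) (v x) x - g (T n x) (S n x) x\<bar> \<partial>?M)"
        by (rule integral_abs_bound)
      also have "\<dots> \<le> (\<integral>x. \<bar>v x - S n x\<bar> \<partial>?M)"
      proof (rule integral_mono)
        fix x assume "x \<in> space ?M"
        then have e: "exp (- Z x) \<le> 1" using Z0 by simp
        have "g (T n x) (v x) x - g (T n x) (S n x) x = (exp (- Z x) * (cos (x + T n x) * cos x)) * (v x - S n x)"
          by (simp add: g_def algebra_simps)
        also have "\<bar>\<dots>\<bar> \<le> 1 * \<bar>v x - S n x\<bar>"
          unfolding abs_mult using e by (intro mult_mono mult_le_one) (auto simp: abs_mult mult_le_one)
        finally show "\<bar>g (T n x) (v x) x - g (T n x) (S n x) x\<bar> \<le> \<bar>v x - S n x\<bar>" by simp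
      qed (use i1 i2 L2_on_integrable[OF D] in auto)
      also have "\<dots> \<le> sqrt (b - a) * L2_norm a b (\<lambda>x. v x - S n x)"
        by (rule L2_integral_abs_le[OF D \<open>a \<le> b\<close>])
      finally show "norm ((\<integral>x. g (T n x) (v x) x \<partial>?M) - (\<integral>x. g (T n x) (S n x) x \<partial>?M))
        \<le> sqrt (b - a) * L2_norm a b (\<lambda>x. v x - S n x)" by simp
    qed
  qed
  ultimately have "(\<lambda>n. \<psi> (T n b) b - \<psi> (T n a) a) \<longlonglongrightarrow> (\<integral>x. g (\<theta> x) (v x) x \<partial>?M)"
    unfolding FTC using tendsto_diff by fastforce
  moreover have "(\<lambda>n. \<psi> (T n b) b - \<psi> (T n a) a) \<longlonglongrightarrow> \<psi> (\<theta> b) b - \<psi> (\<theta> a) a"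
    unfolding \<psi>_def using \<open>a \<le> b\<close> by (intro tendsto_intros T\<theta>) auto
  ultimately have "(\<integral>x. g (\<theta> x) (v x) x \<partial>?M) = \<psi> (\<theta> b) b - \<psi> (\<theta> a) a"
    by (rule LIMSEQ_unique)
  then show ?thesis by (simp add: g_def \<psi>_def)
qed

section \<open>Regularity of the fixed point\<close>

theorem theorem4p3:
  fixes \<alpha> :: real and \<zeta> \<theta> \<tau> :: "real \<Rightarrow> real"
  assumes alpha: "\<alpha> \<ge> 2 / pi * (1 + 1 / (3 * sqrt pi))"
    and L2: "L2_on 0 (pi/2) \<zeta>"
    and nonneg: "\<forall>\<sigma>\<in>{0<..pi/2}. \<zeta> \<sigma> \<ge> 0"
    and fixpt: "\<forall>\<sigma>\<in>{0<..pi/2}. \<zeta> \<sigma> = Phi_op \<alpha> \<zeta> \<sigma>"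
    and normb: "L2_norm 0 (pi/2) \<zeta> \<le> 9 * sqrt pi / 2"
    and theta_def: "\<forall>\<sigma>\<in>{0..pi/2}. \<theta> \<sigma> = (1/3) * H_op \<zeta> \<sigma>"
    and tau_def: "\<forall>\<sigma>\<in>{0..pi/2}. \<tau> \<sigma> = ln (pi/2) + (1/3) * (\<integral>s. \<zeta> s \<partial>lebesgue_on {0..\<sigma>})"
  shows
    "(\<exists>g. weak_deriv 0 (pi/2) (\<lambda>\<sigma>. \<zeta> \<sigma> / 3 * sin \<sigma>) g \<and> L2_on 0 (pi/2) g \<and>
          L2_norm 0 (pi/2) g \<le> 7 / (\<alpha> * sqrt pi))
     \<and> \<zeta> (pi/2) / 3 = 0
     \<and> (\<forall>\<delta>\<in>{0<..<pi/2}. C1_half \<delta> (pi/2) \<tau>)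
     \<and> (\<exists>\<theta>' g. weak_deriv 0 (pi/2) \<theta> \<theta>' \<and>
          weak_deriv 0 (pi/2) (\<lambda>\<sigma>. \<theta>' \<sigma> * sin \<sigma>) g \<and> L2_on 0 (pi/2) g \<and>
          L2_norm 0 (pi/2) g \<le> 7 / (\<alpha> * sqrt pi))
     \<and> (\<forall>\<delta>\<in>{0<..<pi/2}. C1_half \<delta> (pi/2) \<theta>)"
proof -
  let ?M = "lebesgue_on {0..pi/2}"
  have cot0: "cot (pi/2) = (0::real)" by (simp add: cot_def)
  have alpha0: "\<alpha> > 0"
    by (rule less_le_trans[OF _ alpha], intro mult_pos_pos add_pos_pos divide_pos_pos) simp_all
  have \<zeta>i: "integrable ?M \<zeta>" by (rule L2_on_integrable[OF L2])
  define Z where "Z = (\<lambda>x. \<integral>s. \<zeta> s \<partial>lebesgue_on {0..x})"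
  have cZ: "continuous_on {0..pi/2} Z"
    unfolding Z_def by (rule indefinite_integral_continuous_real[OF \<zeta>i])
  \<comment> \<open>The value of \<open>\<zeta>\<close> at \<open>0\<close> is arbitrary, so
    non-negativity is used almost everywhere.\<close>
  have Z0: "0 \<le> Z x" if "x \<in> {0..pi/2}" for x
    unfolding Z_def
  proof (rule integral_nonneg_AE)
    have "AE t in lebesgue_on {0..x}. t \<in> {0..x}" by (rule AE_I2) simp
    then show "AE t in lebesgue_on {0..x}. 0 \<le> \<zeta> t"
      using AE_lebesgue_on_neq[of 0 0 x]
      by eventually_elim (use nonneg that in auto)
  qed
  obtain V r where V: "L2_on 0 (pi/2) V" and V\<zeta>: "L2_norm 0 (pi/2) V \<le> L2_norm 0 (pi/2) \<zeta>"
    and SV: "(\<lambda>n. L2_norm 0 (pi/2) (\<lambda>x. V x - (\<Sum>k<n. sine_coeff 2 \<zeta> k * cos (real (2 * k + 2) * x)))) \<longlonglongrightarrow> 0"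
    and r: "strict_mono (r :: nat \<Rightarrow> nat)"
    and AEV: "AE x in ?M. (\<lambda>n. \<Sum>k<r n. sine_coeff 2 \<zeta> k * cos (real (2 * k + 2) * x)) \<longlonglongrightarrow> V x"
    and coeff0: "sine_coeff 2 \<zeta> \<longlonglongrightarrow> 0"
    and Vs: "\<And>\<sigma>. \<sigma> \<in> {0..pi/2} \<Longrightarrow> (\<lambda>k. sine_coeff 2 \<zeta> k * sin (real (2 * k + 2) * \<sigma>) / real (2 * k + 2))
        sums (\<integral>x. V x \<partial>lebesgue_on {0..\<sigma>})"
    by (rule L2_conjugate[OF L2, of 2]) auto
  \<comment> \<open>Both series have the same terms. Hence \<open>H_op \<zeta>\<close> is the
    primitive of \<open>V\<close>, and \<open>v = V / 3\<close> will be the weak derivative of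
    \<open>\<theta>\<close>.\<close>
  have H: "H_op \<zeta> x = (\<integral>t. V t \<partial>lebesgue_on {0..x})" if "x \<in> {0..pi/2}" for x
    using sums_unique2[OF H_op_sums[OF L2 that] Vs[OF that]] .
  define v where "v = (\<lambda>x. V x / 3)"
  have vL: "L2_on 0 (pi/2) v"
    using L2_on_cmult[OF V, of "1/3"] by (simp add: v_def)
  have vi: "integrable ?M v" by (rule L2_on_integrable[OF vL])
  have zero_int: "(\<integral>t. f t \<partial>lebesgue_on {0..0}) = 0" if "integrable ?M f" for f :: "real \<Rightarrow> real"
    using integral_lebesgue_on_eq_integral[OF that, of 0 0] by simp
  have \<theta>AC: "\<theta> x = \<theta> 0 + (\<integral>t. v t \<partial>lebesgue_on {0..x})" if "x \<in> {0..pi/2}" for x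
    using theta_def[rule_format, OF that] theta_def[rule_format, of 0] H[OF that] H[of 0]
      zero_int[OF L2_on_integrable[OF V]] by (simp add: v_def)
  have c\<theta>: "continuous_on {0..pi/2} \<theta>"
    using indefinite_integral_continuous_real[OF vi]
    by (subst continuous_on_cong[OF refl \<theta>AC]) (auto intro!: continuous_intros)
  \<comment> \<open>Multiplying the fixed point equation by \<open>sin x\<close> turns
    \<open>cot\<close> into \<open>cos\<close> and removes the singularity at the origin.\<close>
  have \<zeta>sin: "\<zeta> x * sin x = 3 / (\<alpha> * pi) * (sin (x + \<theta> x) * cos x * exp (- Z x))" if "x \<in> {0<..pi/2}" for x
  proof -
    have "sin x > 0" using that by (intro sin_gt_zero) auto
    moreover have "x \<in> {0..pi/2}" using that by auto
    then have "\<zeta> x = 3 / (\<alpha> * pi) * (sin (x + \<theta> x) * cot x) / exp (Z x)"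
      using fixpt[rule_format, OF that] theta_def[rule_format] by (simp only: Phi_op_def Z_def)
    ultimately show ?thesis by (simp add: cot_def exp_minus inverse_eq_divide)
  qed
  \<comment> \<open>Continuity is obtained only away from the origin, which is why the chain rule is
    applied below on \<open>{x..pi/2}\<close> with \<open>x > 0\<close>.\<close>
  have c\<zeta>: "continuous_on {\<delta>..pi/2} \<zeta>" if \<delta>: "0 < \<delta>" for \<delta>
  proof -
    have "continuous_on {\<delta>..pi/2} (\<lambda>x. 3 / (\<alpha> * pi) * (sin (x + \<theta> x) * cos x * exp (- Z x)) / sin x)"
    proof (intro continuous_intros continuous_on_subset[OF c\<theta>] continuous_on_subset[OF cZ] ballI)
      fix x assume "x \<in> {\<delta>..pi/2}"
      then have "sin x > 0" using \<delta> by (intro sin_gt_zero) auto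
      then show "sin x \<noteq> 0" by simp
    qed (use \<delta> in auto)
    then show ?thesis
    proof (rule continuous_on_eq)
      fix x assume x: "x \<in> {\<delta>..pi/2}"
      then have "sin x > 0" using \<delta> by (intro sin_gt_zero) auto
      then show "3 / (\<alpha> * pi) * (sin (x + \<theta> x) * cos x * exp (- Z x)) / sin x = \<zeta> x"
        using x \<delta> by (subst \<zeta>sin[symmetric]) auto
    qed
  qed
  \<comment> \<open>The formal derivative of
    \<open>sin (x + \<theta> x) * cos x * exp (- Z x)\<close>, with \<open>v\<close> for the
    derivative of \<open>\<theta>\<close> and \<open>\<zeta>\<close> for that of \<open>Z\<close>.
    Thus \<open>G\<close> is the candidate for the derivative of
    \<open>\<zeta> * sin\<close>.\<close>
  define g where "g = (\<lambda>x. exp (- Z x) * ((1 + v x) * cos (x + \<theta> x) * cos x - sin (x + \<theta> x) * sin x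
      - \<zeta> x * sin (x + \<theta> x) * cos x))"
  define G where "G = (\<lambda>x. 3 / (\<alpha> * pi) * g x)"
  have gL: "L2_on 0 (pi/2) (\<lambda>x. 1 + \<bar>v x\<bar> + \<bar>\<zeta> x\<bar>)"
    by (intro L2_on_add L2_on_const L2_on_abs vL L2)
  have gb: "\<bar>g x\<bar> \<le> \<bar>1 + \<bar>v x\<bar> + \<bar>\<zeta> x\<bar>\<bar>" if "x \<in> {0..pi/2}" for x
  proof -
    have tri: "\<bar>A + B - C\<bar> \<le> 1 + p + q" if "\<bar>A\<bar> \<le> 1" "\<bar>B\<bar> \<le> p" "\<bar>C\<bar> \<le> q" for A B C p q :: real
      using that by linarith
    have sc: "\<bar>cos (x + \<theta> x) * cos x\<bar> \<le> 1" "\<bar>sin (x + \<theta> x) * cos x\<bar> \<le> 1"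
      by (simp_all add: abs_mult mult_le_one)
    \<comment> \<open>The two terms free of \<open>v\<close> and \<open>\<zeta>\<close> combine by
      the addition theorem into one cosine, so they contribute \<open>1\<close> and not
      \<open>2\<close>.\<close>
    have "(1 + v x) * cos (x + \<theta> x) * cos x - sin (x + \<theta> x) * sin x - \<zeta> x * sin (x + \<theta> x) * cos x
      = cos (x + \<theta> x + x) + v x * (cos (x + \<theta> x) * cos x) - \<zeta> x * (sin (x + \<theta> x) * cos x)"
      unfolding cos_add[of "x + \<theta> x" x] by (simp only: distrib_right mult_1 mult.assoc)
    also have "\<bar>\<dots>\<bar> \<le> 1 + \<bar>v x\<bar> + \<bar>\<zeta> x\<bar>"
    proof (rule tri)
      show "\<bar>v x * (cos (x + \<theta> x) * cos x)\<bar> \<le> \<bar>v x\<bar>"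
        using mult_left_mono[OF sc(1), of "\<bar>v x\<bar>"] by (simp add: abs_mult)
      show "\<bar>\<zeta> x * (sin (x + \<theta> x) * cos x)\<bar> \<le> \<bar>\<zeta> x\<bar>"
        using mult_left_mono[OF sc(2), of "\<bar>\<zeta> x\<bar>"] by (simp add: abs_mult)
    qed simp
    finally have "\<bar>g x\<bar> \<le> 1 * (1 + \<bar>v x\<bar> + \<bar>\<zeta> x\<bar>)"
      unfolding g_def abs_mult[of "exp (- Z x)"] using Z0[OF that] by (intro mult_mono) auto
    then show ?thesis by simp
  qed
  have cmeas: "f \<in> borel_measurable ?M" if "continuous_on {0..pi/2} f" for f :: "real \<Rightarrow> real"
    by (rule continuous_imp_measurable_on_sets_lebesgue[OF that]) auto
  have g: "L2_on 0 (pi/2) g"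
  proof (rule L2_on_bound[OF gL _ gb])
    note [measurable] = cmeas[OF cZ] cmeas[OF c\<theta>] L2_onD(1)[OF vL] L2_onD(1)[OF L2]
    have [measurable]: "(\<lambda>x. x) \<in> borel_measurable ?M" by (intro cmeas continuous_intros)
    show "g \<in> borel_measurable ?M" unfolding g_def by measurable
  qed
  have GL: "L2_on 0 (pi/2) G" unfolding G_def by (rule L2_on_cmult[OF g])
  have Gnorm: "L2_norm 0 (pi/2) (\<lambda>x. G x / 3) \<le> 7 / (\<alpha> * sqrt pi)"
  proof -
    have "L2_norm 0 (pi/2) v = L2_norm 0 (pi/2) V / 3"
      using L2_norm_cmult[of 0 "pi/2" "1/3" V] by (simp add: v_def)
    then have "L2_norm 0 (pi/2) v \<le> 3 * sqrt pi / 2" using V\<zeta> normb by simp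
    have "L2_norm 0 (pi/2) g \<le> L2_norm 0 (pi/2) (\<lambda>x. 1 + \<bar>v x\<bar> + \<bar>\<zeta> x\<bar>)"
      by (rule L2_norm_mono[OF g gL gb])
    also have "\<dots> \<le> L2_norm 0 (pi/2) (\<lambda>x. 1 + \<bar>v x\<bar>) + L2_norm 0 (pi/2) (\<lambda>x. \<bar>\<zeta> x\<bar>)"
      by (intro L2_norm_triangle L2_on_add L2_on_const L2_on_abs vL L2)
    also have "L2_norm 0 (pi/2) (\<lambda>x. 1 + \<bar>v x\<bar>) \<le> L2_norm 0 (pi/2) (\<lambda>x. 1) + L2_norm 0 (pi/2) (\<lambda>x. \<bar>v x\<bar>)"
      by (intro L2_norm_triangle L2_on_const L2_on_abs vL)
    also have "L2_norm 0 (pi/2) (\<lambda>x. 1) = sqrt (pi/2)"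
      by (simp add: L2_norm_const)
    also have "sqrt (pi/2) \<le> sqrt pi" by simp
    finally have "L2_norm 0 (pi/2) g \<le> sqrt pi + L2_norm 0 (pi/2) v + L2_norm 0 (pi/2) \<zeta>"
      by (simp add: L2_norm_abs)
    \<comment> \<open>The three summands are at most \<open>1\<close>, \<open>3/2\<close> and
      \<open>9/2\<close> times \<open>sqrt pi\<close>, which add up to \<open>7\<close>.\<close>
    also have "\<dots> \<le> 7 * sqrt pi" using \<open>L2_norm 0 (pi/2) v \<le> 3 * sqrt pi / 2\<close> normb by simp
    finally have gn: "L2_norm 0 (pi/2) g \<le> 7 * sqrt pi" .
    have "L2_norm 0 (pi/2) (\<lambda>x. G x / 3) = 1 / (\<alpha> * pi) * L2_norm 0 (pi/2) g"
      using L2_norm_cmult[of 0 "pi/2" "1 / (\<alpha> * pi)" g] alpha0 by (simp add: G_def)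
    also have "\<dots> \<le> 1 / (\<alpha> * pi) * (7 * sqrt pi)"
      using alpha0 by (intro mult_left_mono gn) auto
    also have "\<dots> = 7 / (\<alpha> * sqrt pi)"
      using alpha0 by (simp add: field_simps)
    finally show ?thesis .
  qed
  \<comment> \<open>Integrating back from \<open>pi/2\<close> builds in the end value zero and keeps
    away from the origin when \<open>U\<close> is identified with
    \<open>\<zeta> * sin\<close>.\<close>
  define U where "U = (\<lambda>x. - (\<integral>t. G t \<partial>lebesgue_on {x..pi/2}))"
  note Gi = L2_on_integrable[OF GL]
  have UAC: "U x = U 0 + (\<integral>t. G t \<partial>lebesgue_on {0..x})" if "x \<in> {0..pi/2}" for x
    using lebesgue_integral_combine[OF Gi, of x "pi/2"] that by (simp add: U_def)
  have U1: "U (pi/2) = 0"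
    using integral_lebesgue_on_eq_integral[OF Gi, of "pi/2" "pi/2"] by (simp add: U_def)
  have U\<zeta>: "U x = \<zeta> x * sin x" if x: "x \<in> {0<..pi/2}" for x
  proof -
    have sub: "{x..pi/2} \<subseteq> {0..pi/2}" using x by auto
    let ?S = "\<lambda>n x. \<Sum>k<n. sine_coeff 2 \<zeta> k * cos (real (2 * k + 2) * x)"
    let ?T = "\<lambda>n x. \<Sum>k<n. sine_coeff 2 \<zeta> k * sin (real (2 * k + 2) * x) / real (2 * k + 2)"
    have SL: "L2_on 0 (pi/2) (?S n)" for n
      by (intro continuous_imp_L2_on continuous_intros)
    \<comment> \<open>The smooth approximations are the partial sums of the series of
      \<open>\<theta>\<close>, with those of \<open>V / 3\<close> as derivatives. The boundary term
      at \<open>pi/2\<close> vanishes with the cosine.\<close>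
    have "(\<integral>t. g t \<partial>lebesgue_on {x..pi/2})
      = sin (pi/2 + \<theta> (pi/2)) * cos (pi/2) * exp (- Z (pi/2)) - sin (x + \<theta> x) * cos x * exp (- Z x)"
      unfolding g_def
    proof (rule chain_rule_limit)
      show "((\<lambda>y. ?T n y / 3) has_real_derivative ?S n y / 3) (at y within {x..pi/2})" for n y
        by (auto intro!: derivative_eq_intros sum.cong simp del: of_nat_add of_nat_mult)
      show "continuous_on {x..pi/2} (\<lambda>y. ?S n y / 3)" for n
        by (intro continuous_intros) auto
      show "(\<lambda>n. ?T n y / 3) \<longlonglongrightarrow> \<theta> y" if "y \<in> {x..pi/2}" for y
      proof -
        have y: "y \<in> {0..pi/2}" using that sub by auto
        have \<theta>y: "\<theta> y = H_op \<zeta> y / 3" using theta_def y by simp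
        show ?thesis
          unfolding \<theta>y by (intro tendsto_divide tendsto_const H_op_sums[OF L2 y, unfolded sums_def]) simp
      qed
      show "L2_on x (pi/2) v" by (rule L2_on_subinterval[OF vL sub])
      show "(\<lambda>n. L2_norm x (pi/2) (\<lambda>y. v y - ?S n y / 3)) \<longlonglongrightarrow> 0"
      proof (rule Lim_null_comparison[OF always_eventually SV], intro allI)
        fix n
        have "L2_norm x (pi/2) (\<lambda>y. v y - ?S n y / 3) = 1/3 * L2_norm x (pi/2) (\<lambda>y. V y - ?S n y)"
          using L2_norm_cmult[of x "pi/2" "1/3" "\<lambda>y. V y - ?S n y"]
          by (simp add: v_def diff_divide_distrib)
        also have "\<dots> \<le> 1 * L2_norm 0 (pi/2) (\<lambda>y. V y - ?S n y)"
          by (intro mult_mono L2_norm_subinterval L2_on_diff V SL sub L2_norm_nonneg) auto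
        finally show "norm (L2_norm x (pi/2) (\<lambda>y. v y - ?S n y / 3)) \<le> L2_norm 0 (pi/2) (\<lambda>y. V y - ?S n y)"
          by (simp add: L2_norm_nonneg)
      qed
      show "continuous_on {x..pi/2} \<theta>" by (rule continuous_on_subset[OF c\<theta> sub])
      show c: "continuous_on {x..pi/2} \<zeta>" using x by (intro c\<zeta>) auto
      show "(Z has_real_derivative \<zeta> y) (at y within {x..pi/2})" if y: "y \<in> {x..pi/2}" for y
      proof (rule has_field_derivative_transform_within[OF _ zero_less_one y])
        show "((\<lambda>y. Z x + integral {x..y} \<zeta>) has_real_derivative \<zeta> y) (at y within {x..pi/2})"
          using integral_has_real_derivative[OF c y] by (auto intro!: derivative_eq_intros)
        show "Z x + integral {x..u} \<zeta> = Z u" if "u \<in> {x..pi/2}" for u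
          using lebesgue_integral_combine[OF \<zeta>i, of x u] integral_lebesgue_on_eq_integral[OF \<zeta>i, of x u] that x
          by (simp add: Z_def)
      qed
    qed (use x sub Z0 in auto)
    then have "(\<integral>t. G t \<partial>lebesgue_on {x..pi/2}) = 3 / (\<alpha> * pi) * - (sin (x + \<theta> x) * cos x * exp (- Z x))"
      unfolding G_def integral_mult_right_zero by simp
    then show ?thesis using \<zeta>sin[OF x] by (simp add: U_def)
  qed
  have AEpos: "AE x in ?M. x \<in> {0<..pi/2}"
  proof -
    have "AE x in ?M. x \<in> {0..pi/2}" by (rule AE_I2) simp
    then show ?thesis using AE_lebesgue_on_neq[of 0 0 "pi/2"] by eventually_elim auto
  qed
  have AEU: "AE x in ?M. U x = \<zeta> x * sin x" using AEpos by eventually_elim (rule U\<zeta>)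
  obtain h where h: "L2_on 0 (pi/2) h" and hG: "L2_norm 0 (pi/2) h \<le> L2_norm 0 (pi/2) G"
    and AEh: "AE x in ?M. V x * sin x = (\<integral>t. h t \<partial>lebesgue_on {0..x})"
    by (rule conjugate_times_sin[OF L2 r AEV coeff0 GL UAC U1 AEU])
  have div3: "L2_on 0 (pi/2) (\<lambda>x. f x / 3)" "L2_norm 0 (pi/2) (\<lambda>x. f x / 3) = L2_norm 0 (pi/2) f / 3"
    if "L2_on 0 (pi/2) f" for f
    using L2_on_cmult[OF that, of "1/3"] L2_norm_cmult[of 0 "pi/2" "1/3" f] by simp_all
  have sinL: "integrable ?M (\<lambda>x. f x * sin x)" if "L2_on 0 (pi/2) f" for f
    by (intro integrable_mult_continuous L2_on_integrable that continuous_intros)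
  \<comment> \<open>\<open>P\<close> is the continuous representative of
    \<open>v * sin\<close>.\<close>
  define P where "P = (\<lambda>x. (\<integral>t. h t / 3 \<partial>lebesgue_on {0..x}))"
  have PAC: "P x = P 0 + (\<integral>t. h t / 3 \<partial>lebesgue_on {0..x})" for x
    using zero_int[OF L2_on_integrable[OF h]] by (simp add: P_def)
  have U3: "U x / 3 = U 0 / 3 + (\<integral>t. G t / 3 \<partial>lebesgue_on {0..x})" if "x \<in> {0..pi/2}" for x
    using UAC[OF that] by simp
  have \<tau>AC: "\<tau> x = \<tau> 0 + (\<integral>t. \<zeta> t / 3 \<partial>lebesgue_on {0..x})" if "x \<in> {0..pi/2}" for x
    using tau_def[rule_format, OF that] tau_def[rule_format, of 0] zero_int[OF \<zeta>i] by simp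
  have pi0: "0 < pi / 2" by simp
  show ?thesis
  proof (intro conjI exI ballI)
    show "weak_deriv 0 (pi/2) (\<lambda>\<sigma>. \<zeta> \<sigma> / 3 * sin \<sigma>) (\<lambda>x. G x / 3)"
    proof (rule weak_deriv_AC[OF pi0 L2_on_integrable[OF div3(1)[OF GL]] U3 sinL[OF div3(1)[OF L2]]])
      show "AE x in ?M. \<zeta> x / 3 * sin x = U x / 3" using AEU by eventually_elim simp
    qed
    show "L2_on 0 (pi/2) (\<lambda>x. G x / 3)" by (rule div3[OF GL])
    show "L2_norm 0 (pi/2) (\<lambda>x. G x / 3) \<le> 7 / (\<alpha> * sqrt pi)" by (rule Gnorm)
    show "\<zeta> (pi/2) / 3 = 0" using fixpt cot0 by (simp add: Phi_op_def)
    show "weak_deriv 0 (pi/2) \<theta> v"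
      by (rule weak_deriv_AC[OF pi0 vi \<theta>AC continuous_imp_integrable_real[OF c\<theta>]]) auto
    show "weak_deriv 0 (pi/2) (\<lambda>\<sigma>. v \<sigma> * sin \<sigma>) (\<lambda>x. h x / 3)"
    proof (rule weak_deriv_AC[OF pi0 L2_on_integrable[OF div3(1)[OF h]] PAC sinL[OF vL]])
      show "AE x in ?M. v x * sin x = P x" using AEh by eventually_elim (simp add: v_def P_def)
    qed
    show "L2_on 0 (pi/2) (\<lambda>x. h x / 3)" by (rule div3[OF h])
    \<comment> \<open>The bound is inherited from \<open>G\<close>, since conjugation does not
      increase the norm.\<close>
    show "L2_norm 0 (pi/2) (\<lambda>x. h x / 3) \<le> 7 / (\<alpha> * sqrt pi)"
      using Gnorm hG unfolding div3(2)[OF h] div3(2)[OF GL] by linarith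
    fix \<delta> :: real assume \<delta>: "\<delta> \<in> {0<..<pi/2}"
    show "C1_half \<delta> (pi/2) \<tau>"
    proof (rule C1_half_div_sin[OF div3(1)[OF GL] U3 L2_on_integrable[OF div3(1)[OF L2]] _ \<tau>AC \<delta>])
      show "AE x in ?M. \<zeta> x / 3 = U x / 3 / sin x"
        using AEpos
      proof eventually_elim
        case (elim x)
        then have "sin x > 0" by (intro sin_gt_zero) auto
        then show ?case using U\<zeta>[OF elim] by simp
      qed
    qed
    show "C1_half \<delta> (pi/2) \<theta>"
    proof (rule C1_half_div_sin[OF div3(1)[OF h] PAC vi _ \<theta>AC \<delta>])
      show "AE x in ?M. v x = P x / sin x"
        using AEpos AEh
      proof eventually_elim
        case (elim x)
        then have "sin x > 0" by (intro sin_gt_zero) auto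
        then show ?case using elim(2) by (simp add: v_def P_def field_simps)
      qed
    qed
  qed
qed

end
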